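(* Suppose that $\nabla E$ is Lipschitz on the Stiefel manifold, i.e. there is $L_0>0$ with $\|\nabla E(U)-\nabla E(V)\|_F\le L_0\|U-V\|_F$ for all $U,V\in\mathcal M^N_{N_g}$. Let $[U^\ast]$ be a local minimizer of $E$ and suppose there are $\delta_1>0$, $\nu_1>0$ such that $\nabla^2_GE(U)[D,D]\ge\nu_1\|D\|_F^2$ for all $[U]\in B([U^\ast],\delta_1)$ and all $D\in\mathcal T_{[U]}\mathcal G^N_{N_g}$; $[U^\ast]$ is the unique local minimizer in $B([U^\ast],\delta_1)$. Suppose the retraction $\mathrm{ortho}$ satisfies, for some constant $C_1>0$ and all $U\in\mathcal M^N_{N_g}$, $D\in\mathcal T_{[U]}\mathcal G^N_{N_g}$, $t\ge 0$, $$\|\mathrm{ortho}(U,D,t)-U\|_F\le C_1t\|D\|_F,\qquad \Big\|\frac{\partial}{\partial t}\mathrm{ortho}(U,D,t)-D\Big\|_F\le C_1t\|D\|_F^2 ,$$ and also $$E(\mathrm{ortho}(U,D,t))-E(\exp_{[U]}(tD))=O(t^3\|D\|_F^3)\qquad\text{for all } t\in[0,1/\|D\|_F),$$ with a constant in $O(\cdot)$ independent of $U,D,t$. Let $\delta_2$ and $\mathcal L$ be as in the context, and let $\{U_n\}_{n\in\mathbb N_0}$ be generated by the Newton method described in the context. If $[U_0]\in B([U^\ast],\delta_2)\cap\mathcal L$, then there exists a sequence $\{\sigma_n\}_{n\in\mathbb N_0}\subset(0,1)$ such that, with this choice in the Newton method (and provided the iteration does not terminate), $\{[U_n]\}$ converges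 to $[U^\ast]$ at least quadratically: there is a constant $\zeta>0$ such that for all sufficiently large $n$ $$\mathrm{dist}_{geo}([U_{n+1}],[U^\ast])\le\zeta\,\mathrm{dist}_{geo}([U_n],[U^\ast])^2 .$$
   Context: Energy. Let $N\le N_g$ be positive integers and $\mathcal M^N_{N_g}=\{U\in\mathbb R^{N_g\times N}:U^TU=I_N\}$. The discretized Kohn–Sham energy is $$E(U)=\tfrac12\mathrm{tr}(U^TLU)+\mathrm{tr}(U^TV_{ext}U)+\tfrac12\rho(U)^TL^\dagger\rho(U)+\rho(U)^T\varepsilon_{xc}(\rho(U)),\quad \rho(U)=\mathrm{diag}(UU^T)\in\mathbb R^{N_g},$$ with $L,V_{ext}\in\mathbb R^{N_g\times N_g}$ symmetric, $L^\dagger$ the generalized inverse of $L$, and $\varepsilon_{xc}(\rho)\in\mathbb R^{N_g}$ a given function of $\rho$; $E$ is assumed sufficiently smooth (at least $C^3$). Here $\mathrm{diag}(A)$ is the column vector of diagonal entries. One has $E(UP)=E(U)$ for orthogonal $P$, so $E$ is well defined on classes $[U]$. Geometry. $\mathcal O^N$ is the set of orthogonal $N\times N$ matrices, $[U]=\{UP:P\in\mathcal O^N\}$, and $\mathcal G^N_{N_g}=\mathcal M^N_{N_g}/\!\sim$ is the Grassmann manifold of classes $[U]$. Tangent space: $\mathcal T_{[U]}\mathcal G^N_{N_g}=\{W\in\mathbb R^{N_g\times N}:W^TU=0\}$. $\langle A,B\rangle=\mathrm{tr}(A^TB)$, $\|\cdot\|_F$ is the Frobenius norm. $\nabla E,\nabla^2E$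 are the Euclidean gradient and Hessian (the latter as a linear map $D\mapsto\nabla^2E(U)[D]$). $\nabla_GE(U)=(I-UU^T)\nabla E(U)$; for $D,D_1,D_2\in\mathcal T_{[U]}\mathcal G^N_{N_g}$, $\nabla_G^2E(U)[D]=(I-UU^T)\nabla^2E(U)[D]-D\,U^T\nabla E(U)$ and $\nabla_G^2E(U)[D_1,D_2]=\langle\nabla_G^2E(U)[D_1],D_2\rangle$. $\mathrm{dist}_F([U],[V])=\min_{P\in\mathcal O^N}\|U-VP\|_F$ and $B([U],\delta)=\{[V]:\mathrm{dist}_F([V],[U])\le\delta\}$. $\mathrm{dist}_{geo}([U],[V])=\|\Theta\|_F$, where $\Theta=\mathrm{Diag}(\theta_1,\dots,\theta_N)$, $\theta_i\in[0,\pi/2]$, and $\cos\theta_i$ are the singular values of $U^TV$. For $D\in\mathcal T_{[U]}\mathcal G^N_{N_g}$ with SVD $D=ASB^T$, the geodesic is $\exp_{[U]}(tD)=[UB\cos(St)B^T+A\sin(St)B^T]$. Constants. $C_0>0$ is a constant with $\|\nabla E(\Psi)\|_F\le C_0$ for all $\Psi\in\mathcal M^N_{N_g}$, and $L_1=L_0+2C_0$. $\delta_2$ is any fixed number in $\big(0,\delta_1/(1+\tfrac{3C_1}{\nu_1}L_1)\big)$, and $E_0>E(U^\ast)$ is fixed such that the level set $\mathcal L=\{[U]\in\mathcal G^N_{N_g}:E(U)\le E_0\}$ satisfies $\mathcal L\cap B([U^\ast],\delta_1)\subset B([U^\ast],\delta_2)$ (such an $E_0$ exists). Retraction. $\mathrm{ortho}(U,D,t)\in\mathcal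 M^N_{N_g}$ is defined for $U\in\mathcal M^N_{N_g}$, $D\in\mathcal T_{[U]}\mathcal G^N_{N_g}$, $t\in\mathbb R$, is smooth, and satisfies $\mathrm{ortho}(U,D,0)=U$, $\frac{\partial}{\partial t}\mathrm{ortho}(U,D,0)=D$. Newton method. Fix $q\in(0,1)$, $\eta\in(0,\frac14)$ and $U_0\in\mathcal M^N_{N_g}$. For $n=0,1,2,\dots$, while $\|\nabla_GE(U_n)\|_F\neq0$: choose $\sigma_n\in(0,1)$ (which may depend on the iterates computed so far); take any $D_n\in\mathcal T_{[U_n]}\mathcal G^N_{N_g}$ with $\|\nabla_G^2E(U_n)[D_n]+\nabla_GE(U_n)\|_F\le\sigma_n\|\nabla_GE(U_n)\|_F$; set $t_n^{\rm init}=-\langle\nabla_GE(U_n),D_n\rangle/\nabla_G^2E(U_n)[D_n,D_n]$ and $t_n=t_n^{\rm init}q^{m_n}$, where $m_n$ is the smallest nonnegative integer such that $E(\mathrm{ortho}(U_n,D_n,t_n))\le E(U_n)+\eta t_n\langle\nabla_GE(U_n),D_n\rangle$; set $U_{n+1}=\mathrm{ortho}(U_n,D_n,t_n)$. *)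

theory Defs
  imports "HOL-Analysis.Analysis"
begin

(* An N_g x N matrix has type real^'k^'g with CARD('g) = N_g rows and CARD('k) = N columns.
   The library's inner and norm on this type are the trace inner product and the
   Frobenius norm. *)

lemma inner_matrix_eq_trace:
  fixes A B :: "real^'k^'g"
  shows "inner A B = trace (transpose A ** B)"
proof -
  have "inner A B = (\<Sum>i\<in>UNIV. \<Sum>j\<in>UNIV. A $ i $ j * B $ i $ j)"
    by (simp add: inner_vec_def)
  also have "\<dots> = (\<Sum>j\<in>UNIV. \<Sum>i\<in>UNIV. A $ i $ j * B $ i $ j)"
    by (rule sum.swap)
  finally show ?thesis
    by (simp add: trace_def matrix_matrix_mult_def transpose_def)
qed

lemma norm_matrix_eq_trace:
  fixes A :: "real^'k^'g"
  shows "norm A = sqrt (trace (transpose A ** A))"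
  by (simp add: norm_eq_sqrt_inner inner_matrix_eq_trace)

definition diag_mat :: "real^'n \<Rightarrow> real^'n^'n" where
  "diag_mat v = (\<chi> i j. if i = j then v $ i else 0)"

(* In finite dimension, f is C^(k+1) on an open set iff it is differentiable there and all its
   directional derivatives are C^k. *)
primrec Ck_on :: "nat \<Rightarrow> ('a::euclidean_space \<Rightarrow> 'b::real_normed_vector) \<Rightarrow> 'a set \<Rightarrow> bool" where
  "Ck_on 0 f S \<longleftrightarrow> continuous_on S f"
| "Ck_on (Suc k) f S \<longleftrightarrow> (\<forall>x\<in>S. f differentiable (at x)) \<and>
     (\<forall>v. Ck_on k (\<lambda>x. frechet_derivative f (at x) v) S)"

(* Smoothness on a set that need not be open (such as an embedded submanifold):
   local extendability to a C^infinity function. *)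
definition smooth_on :: "'a::euclidean_space set \<Rightarrow> ('a \<Rightarrow> 'b::real_normed_vector) \<Rightarrow> bool" where
  "smooth_on S f \<longleftrightarrow> (\<forall>x\<in>S. \<exists>W F. open W \<and> x \<in> W \<and> (\<forall>k. Ck_on k F W) \<and>
     (\<forall>y\<in>S \<inter> W. F y = f y))"

definition gradient :: "('a::real_inner \<Rightarrow> real) \<Rightarrow> 'a \<Rightarrow> 'a" where
  "gradient f x = (THE g. GDERIV f x :> g)"

definition hessian :: "('a::real_inner \<Rightarrow> real) \<Rightarrow> 'a \<Rightarrow> 'a \<Rightarrow> 'a" where
  "hessian f x = frechet_derivative (gradient f) (at x)"


(* The Moore-Penrose inverse, characterized by the four Penrose equations. *)
definition pinv :: "real^'n^'m \<Rightarrow> real^'m^'n" where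
  "pinv A = (THE X. A ** X ** A = A \<and> X ** A ** X = X \<and>
     transpose (A ** X) = A ** X \<and> transpose (X ** A) = X ** A)"

definition electron_density :: "real^'k^'g \<Rightarrow> real^'g" where
  "electron_density U = (\<chi> i. (U ** transpose U) $ i $ i)"

definition ks_energy ::
  "real^'g^'g \<Rightarrow> real^'g^'g \<Rightarrow> (real^'g \<Rightarrow> real^'g) \<Rightarrow> real^'k^'g \<Rightarrow> real" where
  "ks_energy L Vext exc U =
     1/2 * trace (transpose U ** L ** U) + trace (transpose U ** Vext ** U)
     + 1/2 * inner (electron_density U) (pinv L *v electron_density U)
     + inner (electron_density U) (exc (electron_density U))"


definition stiefel :: "(real^'k^'g) set" where
  "stiefel = {U. transpose U ** U = mat 1}"

(* The Grassmann manifold is the set of classes cls U with U in stiefel. *)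
definition cls :: "real^'k^'g \<Rightarrow> (real^'k^'g) set" where
  "cls U = {U ** P | P. orthogonal_matrix P}"

definition tangent :: "real^'k^'g \<Rightarrow> (real^'k^'g) set" where
  "tangent U = {W. transpose W ** U = 0}"

definition grad_G :: "(real^'k^'g \<Rightarrow> real) \<Rightarrow> real^'k^'g \<Rightarrow> real^'k^'g" where
  "grad_G E U = (mat 1 - U ** transpose U) ** gradient E U"

definition hess_G :: "(real^'k^'g \<Rightarrow> real) \<Rightarrow> real^'k^'g \<Rightarrow> real^'k^'g \<Rightarrow> real^'k^'g" where
  "hess_G E U D = (mat 1 - U ** transpose U) ** hessian E U D
     - D ** transpose U ** gradient E U"

definition hess_G2 ::
  "(real^'k^'g \<Rightarrow> real) \<Rightarrow> real^'k^'g \<Rightarrow> real^'k^'g \<Rightarrow> real^'k^'g \<Rightarrow> real" where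
  "hess_G2 E U D1 D2 = inner (hess_G E U D1) D2"

(* The class-level functions dist_F, dist_geo and the geodesic below take representatives of
   classes as arguments. The infimum is a minimum because the orthogonal group is compact. *)
definition dist_F :: "real^'k^'g \<Rightarrow> real^'k^'g \<Rightarrow> real" where
  "dist_F U V = (INF P\<in>{P. orthogonal_matrix P}. norm (U - V ** P))"

definition gr_ball :: "real^'k^'g \<Rightarrow> real \<Rightarrow> (real^'k^'g) set set" where
  "gr_ball U \<delta> = {cls V | V. V \<in> stiefel \<and> dist_F V U \<le> \<delta>}"

definition level_set :: "(real^'k^'g \<Rightarrow> real) \<Rightarrow> real \<Rightarrow> (real^'k^'g) set set" where
  "level_set E E0 = {cls U | U. U \<in> stiefel \<and> E U \<le> E0}"

definition local_minimizer :: "(real^'k^'g \<Rightarrow> real) \<Rightarrow> real^'k^'g \<Rightarrow> bool" where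
  "local_minimizer E U \<longleftrightarrow> U \<in> stiefel \<and>
     (\<exists>\<epsilon>>0. \<forall>V\<in>stiefel. cls V \<in> gr_ball U \<epsilon> \<longrightarrow> E U \<le> E V)"

(* Thin singular value decomposition; for square D the matrix A is orthogonal as well. *)
definition thin_svd :: "real^'k^'g \<Rightarrow> real^'k^'g \<Rightarrow> real^'k \<Rightarrow> real^'k^'k \<Rightarrow> bool" where
  "thin_svd D A s B \<longleftrightarrow> transpose A ** A = mat 1 \<and> (\<forall>i. 0 \<le> s $ i) \<and>
     orthogonal_matrix B \<and> D = A ** diag_mat s ** transpose B"

(* The angles are unique up to their order, which the norm below does not see. *)
definition principal_angles :: "real^'k^'g \<Rightarrow> real^'k^'g \<Rightarrow> real^'k" where
  "principal_angles U V = (SOME \<theta>. (\<forall>i. 0 \<le> \<theta> $ i \<and> \<theta> $ i \<le> pi / 2) \<and>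
     (\<exists>P Q. thin_svd (transpose U ** V) P (\<chi> i. cos (\<theta> $ i)) Q))"

definition dist_geo :: "real^'k^'g \<Rightarrow> real^'k^'g \<Rightarrow> real" where
  "dist_geo U V = norm (diag_mat (principal_angles U V))"

(* A representative of exp_[U](tD); the matrix does not depend on the chosen decomposition. *)
definition geodesic :: "real^'k^'g \<Rightarrow> real^'k^'g \<Rightarrow> real \<Rightarrow> real^'k^'g" where
  "geodesic U D t = (SOME X. \<exists>A s B. thin_svd D A s B \<and>
     X = U ** B ** diag_mat (\<chi> i. cos (s $ i * t)) ** transpose B
       + A ** diag_mat (\<chi> i. sin (s $ i * t)) ** transpose B)"


definition stiefel_retraction ::
  "(real^'k^'g \<Rightarrow> real^'k^'g \<Rightarrow> real \<Rightarrow> real^'k^'g) \<Rightarrow> bool" where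
  "stiefel_retraction ortho \<longleftrightarrow>
     (\<forall>U\<in>stiefel. \<forall>D\<in>tangent U. \<forall>t. ortho U D t \<in> stiefel) \<and>
     smooth_on {(U, D, t). U \<in> stiefel \<and> D \<in> tangent U} (\<lambda>(U, D, t). ortho U D t) \<and>
     (\<forall>U\<in>stiefel. \<forall>D\<in>tangent U. ortho U D 0 = U \<and>
        (ortho U D has_vector_derivative D) (at 0))"

definition armijo ::
  "(real^'k^'g \<Rightarrow> real) \<Rightarrow> (real^'k^'g \<Rightarrow> real^'k^'g \<Rightarrow> real \<Rightarrow> real^'k^'g) \<Rightarrow>
   real \<Rightarrow> real^'k^'g \<Rightarrow> real^'k^'g \<Rightarrow> real \<Rightarrow> bool" where
  "armijo E ortho \<eta> U D t \<longleftrightarrow> E (ortho U D t) \<le> E U + \<eta> * t * inner (grad_G E U) D"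

definition t_init :: "(real^'k^'g \<Rightarrow> real) \<Rightarrow> real^'k^'g \<Rightarrow> real^'k^'g \<Rightarrow> real" where
  "t_init E U D = - inner (grad_G E U) D / hess_G2 E U D D"

definition newton_step ::
  "(real^'k^'g \<Rightarrow> real) \<Rightarrow> (real^'k^'g \<Rightarrow> real^'k^'g \<Rightarrow> real \<Rightarrow> real^'k^'g) \<Rightarrow>
   real \<Rightarrow> real \<Rightarrow> real \<Rightarrow> real^'k^'g \<Rightarrow> real^'k^'g \<Rightarrow> real^'k^'g \<Rightarrow> bool" where
  "newton_step E ortho q \<eta> \<sigma> U D U' \<longleftrightarrow>
     D \<in> tangent U \<and>
     norm (hess_G E U D + grad_G E U) \<le> \<sigma> * norm (grad_G E U) \<and>
     (\<exists>m. armijo E ortho \<eta> U D (t_init E U D * q ^ m) \<and>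
          (\<forall>j<m. \<not> armijo E ortho \<eta> U D (t_init E U D * q ^ j)) \<and>
          U' = ortho U D (t_init E U D * q ^ m))"

(* A non-terminating run started at U0. The tolerance is chosen by a rule \<sigma> that sees exactly the
   iterates computed so far, i.e. the list [U 0, ..., U n] in step n. *)
definition newton_run ::
  "(real^'k^'g \<Rightarrow> real) \<Rightarrow> (real^'k^'g \<Rightarrow> real^'k^'g \<Rightarrow> real \<Rightarrow> real^'k^'g) \<Rightarrow>
   real \<Rightarrow> real \<Rightarrow> ((real^'k^'g) list \<Rightarrow> real) \<Rightarrow> real^'k^'g \<Rightarrow>
   (nat \<Rightarrow> real^'k^'g) \<Rightarrow> (nat \<Rightarrow> real^'k^'g) \<Rightarrow> bool" where
  "newton_run E ortho q \<eta> \<sigma> U0 U D \<longleftrightarrow> U 0 = U0 \<and>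
     (\<forall>n. grad_G E (U n) \<noteq> 0 \<and>
          newton_step E ortho q \<eta> (\<sigma> (map U [0..<Suc n])) (U n) (D n) (U (Suc n)))"

end

theory Submission
  imports Defs
begin

text \<open>
The theorem combines a descent argument, which brings the iterates to the minimizer, with the
classical local analysis of inexact Newton methods. Both need one fact about an energy
that is invariant under the orthogonal group: on the Stiefel manifold its expansion at \<open>U\<close> is
\<open>E(V) = E(U) + \<langle>\<nabla>\<^sub>G E(U), V - U\<rangle> + Q(V - U)/2 + O(\<parallel>V - U\<parallel>\<^sup>3)\<close>, where the
quadratic form \<open>Q\<close> agrees with the Riemannian Hessian on tangent vectors
(\<open>energy_expansion\<close>). The vertical part of the gradient drops out at first order and reappears in
\<open>Q\<close>, because invariance makes \<open>U\<^sup>T \<nabla>E(U)\<close> symmetric and orthonormality makes the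
symmetric part of \<open>U\<^sup>T (V - U)\<close> quadratic. A retracted step is a tangent vector up to second
order, so the energy along it is controlled by the Riemannian gradient and Hessian alone.

The tolerance is the minimum of a small constant and \<open>\<parallel>\<nabla>\<^sub>G E(U\<^sub>n)\<parallel>\<close>. The small constant
makes every direction a descent direction comparable to the gradient, with an initial step
length in \<open>[1/2, 3/2]\<close> (\<open>inexact_newton\<close>). Steps are so short that they cannot leave the ball of
radius \<open>\<delta>1\<close>, and since the energy decreases, the level set condition returns them to the ball of
radius \<open>\<delta>2\<close>. Backtracking accepts lengths bounded away from zero, so each step lowers the energy by a multiple of
\<open>\<parallel>D\<^sub>n\<parallel>\<^sup>2\<close> (\<open>sufficient_decrease\<close>). The energy is bounded below, hence directions and gradients
tend to zero. By coercivity and uniqueness the only critical class in the ball is the minimizer, so by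
compactness a small gradient means a small distance (\<open>near_if_gradient_small\<close>), and the iterates
converge.

Once directions are short, the Armijo test holds for the initial length, because
\<open>\<eta> < 1/4\<close> (\<open>full_step_accepted\<close>). Choose the representative of the minimizing class closest to
\<open>U\<^sub>n\<close>. Its displacement from \<open>U\<^sub>n\<close> is horizontal up to second order and solves the Newton
equation up to second order (\<open>newton_equation_residual\<close>). As the tolerance is at most the norm of the gradient, so does
\<open>D\<^sub>n\<close>, and the step length is 1 up to first order. Therefore the error after the step is quadratic
(\<open>full_step_quadratic\<close>).

Closest representatives come from the singular value decomposition, which is obtained by maximizing a
weighted trace over the orthogonal group (\<open>thin_svd_exists\<close>). The same decomposition expresses both
distances through the principal angles and shows that they are equivalent (\<open>dist_geo_dist_F\<close>).
\<close>

section \<open>The Frobenius norm and the Stiefel manifold\<close>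

lemma norm_matrix_mult_le:
  fixes A :: "real^'n^'m" and B :: "real^'p^'n"
  shows "norm (A ** B) \<le> norm A * norm B"
proof -
  have sq: "(norm X)\<^sup>2 = (\<Sum>i\<in>UNIV. (norm (row i X))\<^sup>2)" for X :: "real^'a^'b"
    by (simp add: power2_norm_eq_inner inner_vec_def row_def)
  have sq': "(norm X)\<^sup>2 = (\<Sum>j\<in>UNIV. (norm (column j X))\<^sup>2)" for X :: "real^'a^'b"
    unfolding power2_norm_eq_inner inner_vec_def column_def
    by (simp add: sum.swap[of _ "UNIV :: 'a set"])
  have "(norm (A ** B))\<^sup>2 = (\<Sum>i\<in>UNIV. \<Sum>j\<in>UNIV. (inner (row i A) (column j B))\<^sup>2)"
    unfolding power2_norm_eq_inner
    by (simp add: inner_vec_def matrix_matrix_mult_def row_def column_def power2_eq_square)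
  also have "\<dots> \<le> (\<Sum>i\<in>UNIV. \<Sum>j\<in>UNIV. (norm (row i A))\<^sup>2 * (norm (column j B))\<^sup>2)"
    by (intro sum_mono) (metis Cauchy_Schwarz_ineq power2_norm_eq_inner)
  also have "\<dots> = (norm A * norm B)\<^sup>2"
    unfolding power_mult_distrib sq[of A] sq'[of B] by (rule sum_product[symmetric])
  finally show ?thesis
    by (rule power2_le_imp_le) simp
qed

interpretation matrix_mult:
  bounded_bilinear "(**) :: real^'n^'m \<Rightarrow> real^'p^'n \<Rightarrow> real^'p^'m"
proof
  fix A A' :: "real^'n^'m" and B B' :: "real^'p^'n" and r :: real
  show "(A + A') ** B = A ** B + A' ** B" "A ** (B + B') = A ** B + A ** B'"
    by (simp_all add: matrix_matrix_mult_def vec_eq_iff sum.distrib algebra_simps)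
  show "(r *\<^sub>R A) ** B = r *\<^sub>R (A ** B)" "A ** (r *\<^sub>R B) = r *\<^sub>R (A ** B)"
    by (simp_all add: matrix_matrix_mult_def vec_eq_iff sum_distrib_left algebra_simps)
  show "\<exists>K. \<forall>(A :: real^'n^'m) (B :: real^'p^'n). norm (A ** B) \<le> norm A * norm B * K"
    by (rule exI[of _ 1]) (simp add: norm_matrix_mult_le)
qed

lemma transpose_add: "transpose (A + B) = transpose A + transpose (B :: real^'n^'m)"
  and transpose_diff: "transpose (A - B) = transpose A - transpose (B :: real^'n^'m)"
  and transpose_scaleR: "transpose (r *\<^sub>R A) = r *\<^sub>R transpose (A :: real^'n^'m)"
  and transpose_zero: "transpose 0 = (0 :: real^'n^'m)"
  by (simp_all add: transpose_def vec_eq_iff)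

lemma inner_matrix_mult_left:
  fixes A :: "real^'n^'m" and B :: "real^'p^'n"
  shows "inner (A ** B) C = inner B (transpose A ** C)"
  by (simp add: inner_matrix_eq_trace matrix_transpose_mul matrix_mul_assoc)

lemma inner_transpose: "inner (transpose A) (transpose B) = inner A (B :: real^'n^'m)"
  unfolding inner_vec_def transpose_def by (simp add: sum.swap[of _ "UNIV :: 'n set"])

lemma norm_transpose: "norm (transpose A) = norm (A :: real^'n^'m)"
  by (simp add: norm_eq_sqrt_inner inner_transpose)

lemma inner_matrix_mult_right:
  fixes A :: "real^'n^'m" and B :: "real^'p^'n"
  shows "inner (A ** B) C = inner A (C ** transpose B)"
proof -
  have "inner (A ** B) C = inner (transpose B ** transpose A) (transpose C)"
    by (metis inner_transpose matrix_transpose_mul)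
  also have "\<dots> = inner (transpose A) (transpose (C ** transpose B))"
    by (simp add: inner_matrix_mult_left matrix_transpose_mul)
  finally show ?thesis by (simp add: inner_transpose)
qed

lemma stiefelD: "U \<in> stiefel \<Longrightarrow> transpose U ** U = mat 1"
  by (simp add: stiefel_def)

lemma orthogonal_iff_stiefel: "orthogonal_matrix (P :: real^'k^'k) \<longleftrightarrow> P \<in> stiefel"
  by (simp add: orthogonal_matrix stiefel_def)

lemma orthogonal_matrix_mult_transpose:
  "orthogonal_matrix (P :: real^'k^'k) \<Longrightarrow> P ** transpose P = mat 1"
  by (simp add: orthogonal_matrix_def)

lemma stiefel_mult_orthogonal:
  assumes "U \<in> stiefel" "orthogonal_matrix P"
  shows "U ** P \<in> stiefel"
proof -
  have "transpose (U ** P) ** (U ** P) = transpose P ** (transpose U ** U) ** P"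
    by (simp add: matrix_transpose_mul matrix_mul_assoc)
  then show ?thesis
    using assms by (simp add: stiefel_def orthogonal_matrix)
qed

lemma norm_stiefel_mult:
  assumes "U \<in> stiefel"
  shows "norm (U ** Y) = norm Y"
  by (simp add: norm_eq_sqrt_inner inner_matrix_mult_left matrix_mul_assoc stiefelD[OF assms])

lemma norm_mult_orthogonal:
  assumes "orthogonal_matrix P"
  shows "norm (X ** P) = norm (X :: real^'k^'g)"
proof -
  have "norm (X ** P) = norm (transpose P ** transpose X)"
    by (metis norm_transpose matrix_transpose_mul)
  also have "\<dots> = norm X"
    using assms
    by (simp add: norm_stiefel_mult norm_transpose orthogonal_matrix_transpose flip: orthogonal_iff_stiefel)
  finally show ?thesis .
qed

text \<open>The columns of \<^term>\<open>U\<close> are orthonormal, so \<^term>\<open>transpose U\<close> discards the part of \<^term>\<open>X\<close>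
orthogonal to them and preserves the norm of the rest.\<close>

lemma norm_stiefel_transpose_mult_le:
  assumes "U \<in> stiefel"
  shows "norm (transpose U ** X) \<le> norm X"
proof -
  let ?Y = "transpose U ** X"
  have "norm ?Y * norm ?Y = inner ?Y ?Y"
    by (simp add: norm_eq_sqrt_inner)
  also have "\<dots> = inner X (U ** ?Y)"
    by (simp add: inner_matrix_mult_left)
  also have "\<dots> \<le> norm X * norm (U ** ?Y)"
    by (rule norm_cauchy_schwarz)
  also have "\<dots> = norm X * norm ?Y"
    by (simp add: norm_stiefel_mult[OF assms])
  finally show ?thesis
    by (metis mult_right_le_imp_le norm_ge_zero order_le_less)
qed

lemma norm_stiefel: 
  assumes "U \<in> stiefel"
  shows "norm (U :: real^'k^'g) = sqrt CARD('k)"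
  by (simp add: norm_matrix_eq_trace stiefelD[OF assms] trace_def mat_def)

lemma compact_stiefel: "compact (stiefel :: (real^'k^'g) set)"
proof -
  have "bounded (stiefel :: (real^'k^'g) set)"
    by (auto simp: bounded_iff norm_stiefel)
  moreover have "continuous_on UNIV (\<lambda>U :: real^'k^'g. transpose U ** U)"
    unfolding transpose_def by (intro matrix_mult.continuous_on continuous_intros)
  then have "closed ((\<lambda>U :: real^'k^'g. transpose U ** U) -` {mat 1})"
    by (intro closed_vimage) auto
  then have "closed (stiefel :: (real^'k^'g) set)"
    by (simp add: stiefel_def vimage_def)
  ultimately show ?thesis
    by (simp add: compact_eq_bounded_closed)
qed

text \<open>The orthogonal projection onto the tangent space at \<^term>\<open>U\<close>. The Riemannian gradient is the
horizontal part of the Euclidean one.\<close>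

definition horizontal :: "real^'k^'g \<Rightarrow> real^'k^'g \<Rightarrow> real^'k^'g" where
  "horizontal U X = (mat 1 - U ** transpose U) ** X"

lemma horizontal_eq: "horizontal U X = X - U ** (transpose U ** X)"
  by (simp add: horizontal_def matrix_mult.diff_left matrix_mul_assoc)

lemma tangent_iff: "D \<in> tangent U \<longleftrightarrow> transpose U ** D = 0"
proof -
  have "transpose (transpose D ** U) = transpose U ** D"
    by (simp add: matrix_transpose_mul)
  then show ?thesis
    unfolding tangent_def mem_Collect_eq by (metis transpose_transpose transpose_zero)
qed

lemmas tangentD = tangent_iff[THEN iffD1]
  and tangentI = tangent_iff[THEN iffD2]

lemma horizontal_tangent:
  assumes "U \<in> stiefel"
  shows "horizontal U X \<in> tangent U"
  by (rule tangentI)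
    (simp add: horizontal_eq matrix_mult.diff_right matrix_mul_assoc stiefelD[OF assms])

lemma horizontal_ident: "D \<in> tangent U \<Longrightarrow> horizontal U D = D"
  by (simp add: horizontal_eq tangentD)

lemma inner_horizontal_commute: "inner (horizontal U X) Y = inner X (horizontal U Y)"
  by (simp add: horizontal_eq inner_diff_left inner_diff_right inner_matrix_mult_left)

lemma horizontal_diff: "horizontal U (X - Y) = horizontal U X - horizontal U Y"
  by (simp add: horizontal_def matrix_mult.diff_right)

lemma norm_horizontal_le:
  assumes "U \<in> stiefel"
  shows "norm (horizontal U X) \<le> norm X"
proof -
  let ?Y = "horizontal U X"
  have "norm ?Y * norm ?Y = inner ?Y ?Y"
    by (simp add: norm_eq_sqrt_inner)
  also have "\<dots> = inner X ?Y"
    by (metis assms horizontal_ident horizontal_tangent inner_horizontal_commute)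
  also have "\<dots> \<le> norm X * norm ?Y"
    by (rule norm_cauchy_schwarz)
  finally show ?thesis
    by (metis mult_right_le_imp_le norm_ge_zero order_le_less)
qed

lemma norm_sq_horizontal:
  "(norm X)\<^sup>2 = (norm (horizontal U X))\<^sup>2 + (norm (transpose U ** X))\<^sup>2" if "U \<in> stiefel"
proof -
  let ?Y = "horizontal U X"
  have "(norm ?Y)\<^sup>2 = inner X ?Y"
    by (metis that horizontal_ident horizontal_tangent inner_horizontal_commute power2_norm_eq_inner)
  also have "\<dots> = (norm X)\<^sup>2 - inner (U ** (transpose U ** X)) X"
    by (simp add: horizontal_eq inner_diff_right power2_norm_eq_inner inner_commute)
  also have "inner (U ** (transpose U ** X)) X = (norm (transpose U ** X))\<^sup>2"
    by (simp only: inner_matrix_mult_left power2_norm_eq_inner)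
  finally show ?thesis by simp
qed

text \<open>Between two points of the Stiefel manifold the symmetric part of the vertical displacement is
of second order. This is the source of the correction term
\<open>D U\<^sup>T \<nabla>E(U)\<close> in the Riemannian Hessian: a first-order term in the vertical
direction contributes at second order.\<close>

lemma stiefel_diff:
  assumes "U \<in> stiefel" "V \<in> stiefel"
  shows "transpose U ** (V - U) + transpose (transpose U ** (V - U)) = - (transpose (V - U) ** (V - U))"
  using assms
  by (simp add: matrix_mult.diff_right matrix_mult.diff_left transpose_diff matrix_transpose_mul stiefelD)

section \<open>Rotations and the singular value decomposition\<close>

text \<open>This is the matrix exponential of \<open>t B\<close>: for a skew matrix with \<open>B\<^sup>3 = -B\<close> the
exponential series collapses to these three terms. It supplies curves in the orthogonal group.\<close>

definition skew_rotation :: "real^'k^'k \<Rightarrow> real \<Rightarrow> real^'k^'k" where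
  "skew_rotation B t = mat 1 + (1 - cos t) *\<^sub>R (B ** B) + sin t *\<^sub>R B"

lemma skew_rotation_0: "skew_rotation B 0 = mat 1"
  by (simp add: skew_rotation_def)

lemma orthogonal_skew_rotation:
  assumes skew: "transpose B = - B" and cube: "B ** B ** B = - B"
  shows "orthogonal_matrix (skew_rotation B t)"
proof -
  define u where "u = 1 - cos t"
  define C where "C = B ** B"
  have CC: "C ** C = - C" and BC: "B ** C = - B" and CB: "C ** B = - B"
    using cube by (simp_all add: C_def matrix_mul_assoc matrix_mult.minus_left)
  have "transpose C = C"
    by (simp add: C_def matrix_transpose_mul skew matrix_mult.minus_left matrix_mult.minus_right)
  then have "transpose (skew_rotation B t) ** skew_rotation B t
      = (mat 1 + u *\<^sub>R C - sin t *\<^sub>R B) ** (mat 1 + u *\<^sub>R C + sin t *\<^sub>R B)"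
    by (simp add: skew_rotation_def transpose_add transpose_scaleR skew u_def flip: C_def)
  also have "\<dots> = mat 1 + (u + u - u * u - sin t * sin t) *\<^sub>R C"
    by (simp add: matrix_mult.add_left matrix_mult.add_right matrix_mult.diff_left
        matrix_mult.scaleR_left matrix_mult.scaleR_right CC BC CB flip: C_def)
      (simp add: vec_eq_iff algebra_simps)
  also have "u + u - u * u - sin t * sin t = 0"
    using sin_cos_squared_add[of t] by (simp add: u_def power2_eq_square algebra_simps)
  finally show ?thesis
    by (simp add: orthogonal_matrix)
qed

lemma has_vector_derivative_skew_rotation:
  "(skew_rotation B has_vector_derivative B) (at 0)"
  unfolding skew_rotation_def[abs_def]
  by (auto intro!: derivative_eq_intros)

text \<open>The generator of the rotations in one coordinate plane. Pairing a matrix with it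
measures the asymmetry of a single pair of entries.\<close>

definition skew_unit :: "'k \<Rightarrow> 'k \<Rightarrow> real^'k^'k" where
  "skew_unit i j = axis i (axis j 1) - axis j (axis i 1)"

lemma axis_axis_mult:
  "axis i (axis j 1) ** axis k (axis l 1) = (if j = k then axis i (axis l 1) else (0 :: real^'k^'k))"
  by (auto simp: vec_eq_iff matrix_matrix_mult_def axis_def if_distrib[of "\<lambda>x. x $ _"]
      if_distrib[of "\<lambda>x. x * _"] cong: if_cong)

lemma transpose_axis_axis: "transpose (axis i (axis j 1)) = (axis j (axis i 1) :: real^'k^'k)"
  by (auto simp: vec_eq_iff transpose_def axis_def)

lemma skew_unit:
  assumes "i \<noteq> j"
  shows "transpose (skew_unit i j) = - skew_unit i j"
    and "skew_unit i j ** skew_unit i j ** skew_unit i j = - skew_unit i j"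
  using assms assms[symmetric]
  by (simp_all add: skew_unit_def transpose_diff transpose_axis_axis matrix_mult.diff_left
      matrix_mult.diff_right matrix_mult.minus_left axis_axis_mult)

lemma inner_skew_unit: "inner N (skew_unit i j) = N $ i $ j - N $ j $ i"
  by (simp add: skew_unit_def inner_diff_right inner_axis)

text \<open>The identity is a critical point of \<^term>\<open>inner N\<close> on the orthogonal group, so the derivative
along every rotation \<^term>\<open>skew_rotation (skew_unit i j)\<close> vanishes, and this derivative is the
difference of the two entries exchanged by transposition.\<close>

lemma symmetric_if_identity_maximizes:
  fixes N :: "real^'k^'k"
  assumes max: "\<And>R. orthogonal_matrix R \<Longrightarrow> inner N R \<le> inner N (mat 1)"
  shows "transpose N = N"
proof -
  have "N $ i $ j = N $ j $ i" for i j
  proof (cases "i = j")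
    case False
    let ?R = "skew_rotation (skew_unit i j)"
    have "((\<lambda>t. inner N (?R t)) has_vector_derivative inner N (skew_unit i j)) (at 0)"
      by (rule bounded_linear.has_vector_derivative[OF bounded_linear_inner_right
            has_vector_derivative_skew_rotation])
    then have "((\<lambda>t. inner N (?R t)) has_real_derivative inner N (skew_unit i j)) (at 0)"
      by (simp add: has_real_derivative_iff_has_vector_derivative)
    moreover have "inner N (?R t) \<le> inner N (?R 0)" for t
      unfolding skew_rotation_0
      by (intro max orthogonal_skew_rotation skew_unit False)
    ultimately have "inner N (skew_unit i j) = 0"
      by (intro DERIV_local_max[of "\<lambda>t. inner N (?R t)" _ 0 1]) auto
    then show ?thesis
      by (simp add: inner_skew_unit)
  qed simp
  then show ?thesis
    by (simp add: vec_eq_iff transpose_def)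
qed

lemma symmetric_matrix_nth: "transpose N = N \<Longrightarrow> N $ i $ j = N $ j $ i"
proof -
  assume "transpose N = N"
  then have "N $ i $ j = transpose N $ i $ j" by simp
  then show ?thesis by (simp add: transpose_def)
qed

lemma transpose_diag_mat: "transpose (diag_mat v) = diag_mat v"
  by (auto simp: diag_mat_def transpose_def vec_eq_iff)

lemma mult_diag_mat_nth: "(X ** diag_mat v) $ i $ j = X $ i $ j * v $ j"
  by (simp add: diag_mat_def matrix_matrix_mult_def if_distrib[of "\<lambda>x. _ * x"] cong: if_cong)

lemma diag_mat_mult: "diag_mat v ** diag_mat w = diag_mat (\<chi> i. v $ i * w $ i)"
  by (simp add: vec_eq_iff mult_diag_mat_nth) (simp add: diag_mat_def)

lemma orthogonal_diag_mat:
  assumes "\<And>i. \<bar>v $ i\<bar> = 1"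
  shows "orthogonal_matrix (diag_mat v)"
proof -
  have "v $ i * v $ i = 1" for i
    using assms[of i] by (metis abs_mult_self_eq mult_1)
  then show ?thesis
    by (simp add: orthogonal_matrix transpose_diag_mat diag_mat_mult)
      (simp add: diag_mat_def mat_def vec_eq_iff)
qed

lemma trace_mult_diag_mat: "trace (X ** diag_mat v) = (\<Sum>i\<in>UNIV. X $ i $ i * v $ i)"
  by (simp add: trace_def mult_diag_mat_nth)

text \<open>Maximize \<open>\<Sum>\<^sub>i w\<^sub>i (P\<^sup>T M Q)\<^sub>i\<^sub>i\<close> over pairs of orthogonal matrices, with
distinct positive weights \<open>w\<^sub>i\<close>. With \<open>X = P\<^sup>T M Q\<close> at a maximizer, varying \<open>P\<close> and
\<open>Q\<close> separately makes two weighted versions of \<open>X\<close> symmetric. Together they give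
\<open>w\<^sub>j\<^sup>2 X\<^sub>i\<^sub>j = w\<^sub>i\<^sup>2 X\<^sub>i\<^sub>j\<close>, so \<open>X\<close> is diagonal, and flipping signs makes it
nonnegative.\<close>

lemma thin_svd_exists: "\<exists>A s B. thin_svd (M :: real^'k^'k) A s B"
proof -
  obtain f :: "'k \<Rightarrow> nat" where f: "inj f"
    using finite_imp_inj_to_nat_seg[of "UNIV :: 'k set"] by auto
  define W :: "real^'k^'k" where "W = diag_mat (\<chi> i. real (Suc (f i)))"
  have W: "transpose W = W"
    by (simp add: W_def transpose_diag_mat)
  define \<Phi> where "\<Phi> = (\<lambda>(P, Q). inner W (transpose P ** M ** Q))"
  have "continuous_on (stiefel \<times> stiefel) \<Phi>"
    unfolding \<Phi>_def case_prod_beta transpose_def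
    by (intro matrix_mult.continuous_on continuous_intros)
  moreover have "compact ((stiefel :: (real^'k^'k) set) \<times> stiefel)"
    by (intro compact_Times compact_stiefel)
  moreover have "mat 1 \<in> (stiefel :: (real^'k^'k) set)"
    by (simp add: stiefel_def)
  ultimately obtain P Q where PQ: "P \<in> stiefel" "Q \<in> stiefel"
    and max: "\<And>P' Q'. P' \<in> stiefel \<Longrightarrow> Q' \<in> stiefel \<Longrightarrow> \<Phi> (P', Q') \<le> \<Phi> (P, Q)"
    using continuous_attains_sup[of "stiefel \<times> stiefel" \<Phi>] by force
  define X where "X = transpose P ** M ** Q"
  have "transpose (X ** W) = X ** W"
  proof (rule symmetric_if_identity_maximizes)
    fix R :: "real^'k^'k"
    assume R: "orthogonal_matrix R"
    have "inner (X ** W) R = inner X (R ** transpose W)"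
      by (rule inner_matrix_mult_right)
    also have "\<dots> = inner W (transpose R ** X)"
      by (simp add: W inner_commute[of X "R ** W"] inner_matrix_mult_left)
    also have "\<dots> = \<Phi> (P ** R, Q)"
      by (simp add: \<Phi>_def X_def matrix_transpose_mul matrix_mul_assoc)
    also have "\<dots> \<le> \<Phi> (P, Q)"
      by (intro max stiefel_mult_orthogonal PQ R)
    also have "\<dots> = inner X (mat 1 ** transpose W)"
      by (simp add: \<Phi>_def X_def W inner_commute[of W "transpose P ** M ** Q"])
    also have "\<dots> = inner (X ** W) (mat 1)"
      by (rule inner_matrix_mult_right[symmetric])
    finally show "inner (X ** W) R \<le> inner (X ** W) (mat 1)" .
  qed
  moreover have "transpose (transpose X ** W) = transpose X ** W"
  proof (rule symmetric_if_identity_maximizes)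
    fix R :: "real^'k^'k"
    assume R: "orthogonal_matrix R"
    have "inner (transpose X ** W) R = \<Phi> (P, Q ** R)"
      by (simp add: \<Phi>_def X_def inner_matrix_mult_left matrix_mul_assoc)
    also have "\<dots> \<le> \<Phi> (P, Q)"
      by (intro max stiefel_mult_orthogonal PQ R)
    also have "\<dots> = inner (transpose X ** W) (mat 1)"
      by (simp add: \<Phi>_def X_def inner_matrix_mult_left)
    finally show "inner (transpose X ** W) R \<le> inner (transpose X ** W) (mat 1)" .
  qed
  ultimately have sym: "(X ** W) $ i $ j = (X ** W) $ j $ i"
      "(transpose X ** W) $ i $ j = (transpose X ** W) $ j $ i" for i j
    by (blast intro: symmetric_matrix_nth)+
  \<comment> \<open>The weights are distinct and positive, hence have distinct squares.\<close>
  have X0: "X $ i $ j = 0" if "i \<noteq> j" for i j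
  proof -
    define a b where "a = real (Suc (f i))" and "b = real (Suc (f j))"
    have ab: "a > 0" "b > 0" "a \<noteq> b"
      using that f by (auto simp: a_def b_def inj_eq)
    have "X $ i $ j * b = X $ j $ i * a" "X $ j $ i * b = X $ i $ j * a"
      using sym(1)[of i j] sym(2)[of i j]
      by (simp_all add: W_def mult_diag_mat_nth a_def b_def transpose_def)
    then have "X $ i $ j * (b * b) = X $ i $ j * (a * a)"
      by (metis mult.assoc mult.commute)
    then show ?thesis
      using ab by (metis abs_of_pos abs_mult_self_eq mult_cancel_left square_eq_iff less_asym neg_less_0_iff_less)
  qed
  define s where "s = (\<chi> i. \<bar>X $ i $ i\<bar>)"
  define e where "e = (\<chi> i. if X $ i $ i < 0 then - 1 else (1 :: real))"
  have X: "X = diag_mat e ** diag_mat s"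
    unfolding diag_mat_mult using X0 by (auto simp: vec_eq_iff diag_mat_def e_def s_def)
  have "P ** diag_mat e \<in> stiefel"
    by (intro stiefel_mult_orthogonal PQ orthogonal_diag_mat) (simp add: e_def)
  moreover have "M = P ** X ** transpose Q"
  proof -
    have "P ** X ** transpose Q = (P ** transpose P) ** M ** (Q ** transpose Q)"
      by (simp add: X_def matrix_mul_assoc)
    then show ?thesis
      using PQ by (simp add: orthogonal_matrix_mult_transpose orthogonal_iff_stiefel)
  qed
  moreover have "0 \<le> s $ i" for i
    by (simp add: s_def)
  ultimately have "thin_svd M (P ** diag_mat e) s Q"
    using PQ stiefelD[of "P ** diag_mat e"]
    by (simp add: thin_svd_def orthogonal_iff_stiefel X matrix_mul_assoc)
  then show ?thesis by blast
qed

text \<open>A diagonal entry is the inner product of two unit columns.\<close>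

lemma transpose_mult_stiefel_nth_le:
  assumes "X \<in> stiefel" "Y \<in> stiefel"
  shows "(transpose X ** Y) $ i $ i \<le> 1"
proof -
  have col: "norm (column i Z) = 1" if "Z \<in> stiefel" for Z :: "real^'a^'b" and i
  proof -
    have "inner (column i Z) (column i Z) = (transpose Z ** Z) $ i $ i"
      by (simp add: inner_vec_def column_def matrix_matrix_mult_def transpose_def)
    then show ?thesis
      by (simp add: norm_eq_sqrt_inner stiefelD[OF that] mat_def)
  qed
  have "(transpose X ** Y) $ i $ i = inner (column i X) (column i Y)"
    by (simp add: inner_vec_def column_def matrix_matrix_mult_def transpose_def)
  also have "\<dots> \<le> 1"
    using norm_cauchy_schwarz[of "column i X" "column i Y"] by (simp add: col assms)
  finally show ?thesis .
qed

lemma thin_svd_nth: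
  assumes "thin_svd (M :: real^'k^'k) A s B"
  shows "s $ i = (transpose A ** M ** B) $ i $ i"
proof -
  have "transpose A ** M ** B = (transpose A ** A) ** diag_mat s ** (transpose B ** B)"
    using assms by (simp add: thin_svd_def matrix_mul_assoc)
  then show ?thesis
    using assms by (simp add: thin_svd_def orthogonal_matrix diag_mat_def)
qed

text \<open>The singular values of \<open>U\<^sup>T V\<close> are at most 1 because they are inner products of unit
columns of rotated representatives. So their arc cosines are admissible angles, and the choice in
the definition of \<^const>\<open>principal_angles\<close> is not empty.\<close>

lemma principal_angles:
  assumes "U \<in> stiefel" "V \<in> stiefel"
  shows "\<forall>i. 0 \<le> principal_angles U V $ i \<and> principal_angles U V $ i \<le> pi / 2"
    and "\<exists>P Q. thin_svd (transpose U ** V) P (\<chi> i. cos (principal_angles U V $ i)) Q"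
proof -
  obtain A s B where svd: "thin_svd (transpose U ** V) A s B"
    using thin_svd_exists by blast
  have "s $ i \<le> 1" for i
  proof -
    have "s $ i = (transpose (U ** A) ** (V ** B)) $ i $ i"
      using thin_svd_nth[OF svd] by (simp add: matrix_transpose_mul matrix_mul_assoc)
    also have "\<dots> \<le> 1"
      using svd assms
      by (intro transpose_mult_stiefel_nth_le stiefel_mult_orthogonal)
        (auto simp: thin_svd_def orthogonal_matrix)
    finally show ?thesis .
  qed
  moreover have "s $ i \<ge> 0" for i
    using svd by (simp add: thin_svd_def)
  ultimately have s: "0 \<le> arccos (s $ i)" "arccos (s $ i) \<le> pi / 2" "cos (arccos (s $ i)) = s $ i" for i
    by (auto intro!: arccos_lbound arccos_le_pi2 cos_arccos intro: order_trans[of _ 0]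
        simp del: le_divide_eq_numeral1)
  let ?spec = "\<lambda>\<theta>. (\<forall>i. 0 \<le> \<theta> $ i \<and> \<theta> $ i \<le> pi / 2) \<and>
     (\<exists>P Q. thin_svd (transpose U ** V) P (\<chi> i. cos (\<theta> $ i)) Q)"
  have "?spec (\<chi> i. arccos (s $ i))"
    using s svd by auto
  then have "?spec (principal_angles U V)"
    unfolding principal_angles_def by (rule someI)
  then show "\<forall>i. 0 \<le> principal_angles U V $ i \<and> principal_angles U V $ i \<le> pi / 2"
    "\<exists>P Q. thin_svd (transpose U ** V) P (\<chi> i. cos (principal_angles U V $ i)) Q" by auto
qed

section \<open>Aligned representatives and distances of classes\<close>

lemma norm_stiefel_diff_sq:
  fixes U V :: "real^'k^'g"
  assumes "U \<in> stiefel" "V \<in> stiefel"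
  shows "(norm (U - V))\<^sup>2 = 2 * real CARD('k) - 2 * inner U V"
proof -
  have "inner U U = real CARD('k)" "inner V V = real CARD('k)"
    using norm_stiefel[OF assms(1)] norm_stiefel[OF assms(2)] by (simp_all add: dot_square_norm)
  then show ?thesis
    by (simp add: power2_norm_eq_inner inner_diff_left inner_diff_right inner_commute[of V U])
qed

text \<open>The singular value decomposition of \<open>U\<^sup>T V\<close> solves the orthogonal Procrustes problem. For
orthogonal \<open>R\<close>, \<open>\<langle>U, V R\<rangle>\<close> is the sum of the singular values weighted by the diagonal
of an orthogonal matrix. It is largest when that matrix is the identity, that is for \<open>R = P\<close>.
This representative also makes \<open>U\<^sup>T V P\<close> symmetric.\<close>

lemma svd_alignment:
  fixes U V :: "real^'k^'g"
  assumes U: "U \<in> stiefel" and V: "V \<in> stiefel" and svd: "thin_svd (transpose U ** V) A s B"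
  defines "P \<equiv> B ** transpose A"
  shows "orthogonal_matrix P"
    and "transpose (transpose U ** (V ** P)) = transpose U ** (V ** P)"
    and "transpose (transpose V ** (U ** transpose P)) = transpose V ** (U ** transpose P)"
    and "(norm (U - V ** P))\<^sup>2 = (\<Sum>i\<in>UNIV. 2 * (1 - s $ i))"
    and "dist_F U V = norm (U - V ** P)"
proof -
  have A: "orthogonal_matrix A" and B: "orthogonal_matrix B" and s: "\<And>i. 0 \<le> s $ i"
    and UV: "transpose U ** V = A ** diag_mat s ** transpose B"
    using svd by (simp_all add: thin_svd_def orthogonal_matrix)
  have AA: "transpose A ** A = mat 1" and BB: "transpose B ** B = mat 1"
    using A B by (simp_all add: orthogonal_matrix)
  show P: "orthogonal_matrix P"
    unfolding P_def using A B by (simp add: orthogonal_matrix_mul orthogonal_matrix_transpose)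
  have "transpose U ** (V ** P) = A ** diag_mat s ** (transpose B ** B) ** transpose A"
    by (simp add: P_def matrix_mul_assoc UV)
  then have UVP: "transpose U ** (V ** P) = A ** diag_mat s ** transpose A"
    by (simp add: BB)
  then show "transpose (transpose U ** (V ** P)) = transpose U ** (V ** P)"
    by (simp add: matrix_transpose_mul transpose_diag_mat matrix_mul_assoc)
  have "transpose V ** U = B ** diag_mat s ** transpose A"
    using arg_cong[OF UV, of transpose]
    by (simp add: matrix_transpose_mul transpose_diag_mat matrix_mul_assoc)
  then have "transpose V ** (U ** transpose P) = B ** diag_mat s ** (transpose A ** A) ** transpose B"
    by (simp add: P_def matrix_transpose_mul matrix_mul_assoc)
  then show "transpose (transpose V ** (U ** transpose P)) = transpose V ** (U ** transpose P)"
    by (simp add: AA matrix_transpose_mul transpose_diag_mat matrix_mul_assoc)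
  have inner_UVR: "inner U (V ** R) = (\<Sum>i\<in>UNIV. (transpose B ** (R ** A)) $ i $ i * s $ i)" for R
  proof -
    have "inner U (V ** R) = trace ((A ** diag_mat s) ** (transpose B ** R))"
      by (simp add: inner_matrix_eq_trace matrix_mul_assoc UV)
    also have "\<dots> = trace ((transpose B ** R) ** (A ** diag_mat s))"
      by (rule trace_mul_sym)
    also have "\<dots> = trace ((transpose B ** (R ** A)) ** diag_mat s)"
      by (simp add: matrix_mul_assoc)
    finally show ?thesis
      by (simp add: trace_mult_diag_mat)
  qed
  have "transpose B ** (P ** A) = (transpose B ** B) ** (transpose A ** A)"
    by (simp add: P_def matrix_mul_assoc)
  then have inner_UVP: "inner U (V ** P) = (\<Sum>i\<in>UNIV. s $ i)"
    unfolding inner_UVR by (simp add: AA BB) (simp add: mat_def)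
  then show "(norm (U - V ** P))\<^sup>2 = (\<Sum>i\<in>UNIV. 2 * (1 - s $ i))"
    by (simp add: norm_stiefel_diff_sq U V P stiefel_mult_orthogonal sum_subtractf
        flip: sum_distrib_left)
  have least: "norm (U - V ** P) \<le> norm (U - V ** R)" if R: "orthogonal_matrix R" for R
  proof (rule power2_le_imp_le)
    have "(transpose B ** (R ** A)) $ i $ i \<le> 1" for i
      using A B R by (intro transpose_mult_stiefel_nth_le stiefel_mult_orthogonal)
        (simp_all add: orthogonal_iff_stiefel)
    then have "inner U (V ** R) \<le> inner U (V ** P)"
      unfolding inner_UVP unfolding inner_UVR
      using s by (intro sum_mono) (simp add: mult_le_cancel_right2 leD)
    then show "(norm (U - V ** P))\<^sup>2 \<le> (norm (U - V ** R))\<^sup>2"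
      by (simp add: norm_stiefel_diff_sq U V P R stiefel_mult_orthogonal)
  qed simp
  show "dist_F U V = norm (U - V ** P)"
    unfolding dist_F_def
    by (intro cInf_eq_minimum) (use P least in auto)
qed

lemma dist_F_le:
  assumes "orthogonal_matrix P"
  shows "dist_F U V \<le> norm (U - V ** P)"
  unfolding dist_F_def
  by (rule cINF_lower) (use assms in \<open>auto intro: bdd_belowI2[of _ 0]\<close>)

text \<open>Symmetry is what the alignment is for: with the orthonormality of both
representatives it makes the vertical part of the displacement between the two representatives quadratically small. The two symmetric matrices
serve the two choices of base point.\<close>

lemma aligned_representative:
  assumes "U \<in> stiefel" "V \<in> stiefel"
  obtains P where "orthogonal_matrix P" "dist_F U V = norm (U - V ** P)"
    "transpose (transpose U ** (V ** P)) = transpose U ** (V ** P)"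
    "transpose (transpose V ** (U ** transpose P)) = transpose V ** (U ** transpose P)"
proof -
  obtain A s B where svd: "thin_svd (transpose U ** V) A s B"
    using thin_svd_exists by blast
  then show ?thesis
    using that svd_alignment[OF assms svd] by blast
qed

lemma le_two_sin:
  assumes "0 \<le> x" "x \<le> pi / 3"
  shows "x \<le> 2 * sin (x :: real)"
proof -
  have "2 * sin 0 - 0 \<le> 2 * sin x - x"
  proof (rule DERIV_nonneg_imp_nondecreasing[OF assms(1)])
    fix y :: real
    assume y: "0 \<le> y" "y \<le> x"
    then have "cos (pi / 3) \<le> cos y"
      using assms by (intro cos_monotone_0_pi_le) auto
    then have "0 \<le> 2 * cos y - 1"
      by (simp add: cos_60)
    moreover have "((\<lambda>x. 2 * sin x - x) has_real_derivative 2 * cos y - 1) (at y)"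
      by (auto intro!: derivative_eq_intros)
    ultimately show "\<exists>z. ((\<lambda>x. 2 * sin x - x) has_real_derivative z) (at y) \<and> 0 \<le> z"
      by blast
  qed
  then show ?thesis by simp
qed

text \<open>Both distances are functions of the same principal angles: the square of \<^const>\<open>dist_F\<close> is the
sum of \<open>(2 sin(\<theta>\<^sub>i/2))\<^sup>2\<close> and the square of \<^const>\<open>dist_geo\<close> is the sum of
\<open>\<theta>\<^sub>i\<^sup>2\<close>. Hence rates of convergence agree for the two distances, and all estimates
below use \<^const>\<open>dist_F\<close>.\<close>

lemma dist_geo_dist_F:
  fixes U V :: "real^'k^'g"
  assumes "U \<in> stiefel" "V \<in> stiefel"
  shows "dist_F U V \<le> dist_geo U V" and "dist_geo U V \<le> 2 * dist_F U V"
proof -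
  let ?\<theta> = "principal_angles U V"
  obtain P Q where svd: "thin_svd (transpose U ** V) P (\<chi> i. cos (?\<theta> $ i)) Q"
    using principal_angles(2)[OF assms] by blast
  have F: "(dist_F U V)\<^sup>2 = (\<Sum>i\<in>UNIV. 2 * (1 - cos (?\<theta> $ i)))"
    using svd_alignment(4,5)[OF assms svd] by simp
  have geo: "(dist_geo U V)\<^sup>2 = (\<Sum>i\<in>UNIV. (?\<theta> $ i)\<^sup>2)"
    unfolding dist_geo_def power2_norm_eq_inner
    by (simp add: inner_vec_def diag_mat_def power2_eq_square if_distrib[of "\<lambda>x. x * _"] cong: if_cong)
  have half: "2 * (1 - cos x) = (2 * sin (x / 2))\<^sup>2" for x :: real
    using cos_double_sin[of "x / 2"] by (simp add: power2_eq_square)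
  have "(dist_F U V)\<^sup>2 \<le> (dist_geo U V)\<^sup>2"
    unfolding F geo half
  proof (rule sum_mono)
    fix i
    show "(2 * sin (?\<theta> $ i / 2))\<^sup>2 \<le> (?\<theta> $ i)\<^sup>2"
      using abs_sin_x_le_abs_x[of "?\<theta> $ i / 2"] by (intro iffD1[OF abs_le_square_iff]) simp
  qed
  then show "dist_F U V \<le> dist_geo U V"
    by (rule power2_le_imp_le) (simp add: dist_geo_def)
  have "(dist_geo U V)\<^sup>2 \<le> (\<Sum>i\<in>UNIV. 4 * (2 * (1 - cos (?\<theta> $ i))))"
    unfolding geo half
  proof (rule sum_mono)
    fix i
    have "0 \<le> ?\<theta> $ i" "?\<theta> $ i \<le> pi / 2"
      using principal_angles(1)[OF assms] by auto
    then have "?\<theta> $ i / 2 \<le> 2 * sin (?\<theta> $ i / 2)"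
      by (intro le_two_sin) auto
    then have "(?\<theta> $ i)\<^sup>2 \<le> (2 * (2 * sin (?\<theta> $ i / 2)))\<^sup>2"
      using \<open>0 \<le> ?\<theta> $ i\<close> by (intro power_mono) auto
    then show "(?\<theta> $ i)\<^sup>2 \<le> 4 * (2 * sin (?\<theta> $ i / 2))\<^sup>2"
      by (simp add: power_mult_distrib)
  qed
  also have "\<dots> = (2 * dist_F U V)\<^sup>2"
    unfolding F power_mult_distrib by (simp add: sum_distrib_left)
  finally show "dist_geo U V \<le> 2 * dist_F U V"
  proof (rule power2_le_imp_le)
    show "0 \<le> 2 * dist_F U V"
      using svd_alignment(5)[OF assms svd] by simp
  qed
qed

lemma dist_F_nonneg:
  assumes "U \<in> stiefel" "V \<in> stiefel"
  shows "0 \<le> dist_F U V"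
  by (metis assms aligned_representative norm_ge_zero)

lemma dist_F_triangle:
  assumes "V \<in> stiefel" "W \<in> stiefel"
  shows "dist_F U W \<le> norm (U - V) + dist_F V W"
proof -
  obtain P where P: "orthogonal_matrix P" "dist_F V W = norm (V - W ** P)"
    by (metis assms aligned_representative)
  have "dist_F U W \<le> norm (U - W ** P)"
    by (rule dist_F_le[OF P(1)])
  also have "\<dots> \<le> norm (U - V) + norm (V - W ** P)"
    using norm_triangle_ineq[of "U - V" "V - W ** P"] by simp
  finally show ?thesis
    by (simp add: P(2))
qed

lemma cls_eqE:
  assumes "cls U = cls V"
  obtains P where "orthogonal_matrix P" "V = U ** P"
proof -
  have "V \<in> cls V"
    unfolding cls_def by (auto intro!: exI[of _ "mat 1"] simp: orthogonal_matrix_id)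
  then show ?thesis
    using that assms unfolding cls_def by blast
qed

lemma dist_F_mult_orthogonal_le:
  assumes "U \<in> stiefel" "W \<in> stiefel" "orthogonal_matrix P"
  shows "dist_F (U ** P) W \<le> dist_F U W"
proof -
  obtain R where R: "orthogonal_matrix R" "dist_F U W = norm (U - W ** R)"
    by (metis assms aligned_representative)
  have "dist_F (U ** P) W \<le> norm (U ** P - W ** (R ** P))"
    by (intro dist_F_le orthogonal_matrix_mul R assms)
  also have "U ** P - W ** (R ** P) = (U - W ** R) ** P"
    by (simp add: matrix_mult.diff_left matrix_mul_assoc)
  finally show ?thesis
    by (simp add: norm_mult_orthogonal assms R)
qed

lemma gr_ball_iff:
  assumes "V \<in> stiefel" "U \<in> stiefel"
  shows "cls V \<in> gr_ball U \<delta> \<longleftrightarrow> dist_F V U \<le> \<delta>"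
proof
  assume "cls V \<in> gr_ball U \<delta>"
  then obtain V' where V': "V' \<in> stiefel" "dist_F V' U \<le> \<delta>" "cls V' = cls V"
    unfolding gr_ball_def by auto
  then obtain P where "orthogonal_matrix P" "V = V' ** P"
    using cls_eqE by blast
  with V' show "dist_F V U \<le> \<delta>"
    using dist_F_mult_orthogonal_le[OF V'(1) assms(2)] by fastforce
qed (use assms in \<open>auto simp: gr_ball_def\<close>)

lemma dist_F_eq_0_if_cls_eq:
  assumes "cls V = cls U" "V \<in> stiefel" "U \<in> stiefel"
  shows "dist_F V U = 0"
proof -
  obtain P where "orthogonal_matrix P" "V = U ** P"
    using cls_eqE assms by metis
  then have "dist_F V U \<le> 0"
    using dist_F_le[of P V U] by simp
  then show ?thesis
    using dist_F_nonneg[OF assms(2,3)] by simp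
qed

section \<open>Uniform Taylor estimates on compact sets\<close>

lemma GDERIV_gradient:
  assumes "GDERIV f x :> g"
  shows "gradient f x = g"
proof -
  have "g' = g" if "GDERIV f x :> g'" for g'
  proof -
    have "(\<lambda>h. inner h g') = (\<lambda>h. inner h g)"
      using that assms unfolding gderiv_def by (rule has_derivative_unique)
    from fun_cong[OF this, of "g' - g"] have "inner (g' - g) (g' - g) = 0"
      by (simp add: inner_diff_right)
    then show ?thesis by simp
  qed
  then show ?thesis
    unfolding gradient_def using assms by (intro the_equality)
qed

lemma linear_Basis_expansion:
  fixes f :: "'a::euclidean_space \<Rightarrow> 'b::real_vector"
  assumes "linear f"
  shows "f h = (\<Sum>b\<in>Basis. (h \<bullet> b) *\<^sub>R f b)"
proof -
  have "f h = f (\<Sum>b\<in>Basis. (h \<bullet> b) *\<^sub>R b)"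
    by (simp add: euclidean_representation)
  also have "\<dots> = (\<Sum>b\<in>Basis. (h \<bullet> b) *\<^sub>R f b)"
    by (simp add: linear_sum[OF assms] linear_scale[OF assms])
  finally show ?thesis .
qed

lemma linear_frechet_derivative: "f differentiable at x \<Longrightarrow> linear (frechet_derivative f (at x))"
  using frechet_derivative_works has_derivative_linear by blast

text \<open>The gradient as a combination of partial derivatives. Unlike \<^const>\<open>gradient\<close>, which is
given by a definite description, it can be differentiated term by term.\<close>

definition grad_sum :: "('a::euclidean_space \<Rightarrow> real) \<Rightarrow> 'a \<Rightarrow> 'a" where
  "grad_sum f x = (\<Sum>b\<in>Basis. frechet_derivative f (at x) b *\<^sub>R b)"

lemma GDERIV_grad_sum:
  assumes "f differentiable at x"
  shows "GDERIV f x :> grad_sum f x"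
proof -
  have "frechet_derivative f (at x) h = h \<bullet> grad_sum f x" for h
    using linear_Basis_expansion[OF linear_frechet_derivative[OF assms], of h]
    by (simp add: grad_sum_def inner_sum_right mult.commute)
  then have "frechet_derivative f (at x) = (\<lambda>h. h \<bullet> grad_sum f x)"
    by blast
  then show ?thesis
    using assms[THEN iffD1[OF frechet_derivative_works]] by (simp add: gderiv_def)
qed

lemma has_derivative_gradient:
  fixes f :: "'a::euclidean_space \<Rightarrow> real"
  assumes "open S" "x \<in> S" and diff: "\<And>y. y \<in> S \<Longrightarrow> f differentiable at y"
    and diff2: "\<And>b. (\<lambda>y. frechet_derivative f (at y) b) differentiable at x"
  shows "(gradient f has_derivative
    (\<lambda>h. \<Sum>b\<in>Basis. frechet_derivative (\<lambda>y. frechet_derivative f (at y) b) (at x) h *\<^sub>R b)) (at x)"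
proof -
  have "(grad_sum f has_derivative
    (\<lambda>h. \<Sum>b\<in>Basis. frechet_derivative (\<lambda>y. frechet_derivative f (at y) b) (at x) h *\<^sub>R b)) (at x)"
    unfolding grad_sum_def
    by (intro has_derivative_sum has_derivative_scaleR_left diff2[THEN iffD1[OF frechet_derivative_works]])
  then show ?thesis
    by (rule has_derivative_transform_within_open[OF _ assms(1,2)])
      (simp add: GDERIV_gradient[OF GDERIV_grad_sum[OF diff]])
qed


lemma continuous_on_if_all_differentiable:
  "(\<And>x. x \<in> S \<Longrightarrow> f differentiable at x) \<Longrightarrow> continuous_on S f"
  by (simp add: continuous_at_imp_continuous_on differentiable_imp_continuous_within)

text \<open>Used for pairs of points at distance at least \<open>e\<close>, where a bound of low order
in the distance can be traded for one of higher order.\<close>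

lemma dominated_by_power:
  fixes a d e :: real
  assumes "0 \<le> a" "0 < e" "e \<le> d"
  shows "a * d ^ m \<le> a / e ^ k * d ^ (m + k)"
proof -
  have "e ^ k \<le> d ^ k"
    using assms by (intro power_mono) auto
  then have "1 \<le> d ^ k / e ^ k"
    using assms by simp
  then have "a * d ^ m * 1 \<le> a * d ^ m * (d ^ k / e ^ k)"
    using assms by (intro mult_left_mono) auto
  then show ?thesis
    by (simp add: power_add mult_ac)
qed

lemma continuous_bounded_on_compact:
  fixes f :: "'a::topological_space \<Rightarrow> 'b::real_normed_vector"
  assumes "compact S" "continuous_on S f"
  obtains B where "B \<ge> 0" "\<And>x. x \<in> S \<Longrightarrow> norm (f x) \<le> B"
proof -
  have "bounded (f ` S)"
    using assms by (intro compact_imp_bounded compact_continuous_image)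
  then obtain B where "\<forall>y\<in>f ` S. norm y \<le> B"
    by (auto simp: bounded_iff)
  then show ?thesis
    using that[of "max 0 B"] by fastforce
qed

text \<open>The third partial derivatives are bounded on a compact neighbourhood of \<^term>\<open>S\<close>, so the
Hessian is Lipschitz along short segments that start in \<^term>\<open>S\<close>, and integrating once and twice gives
the two expansions for nearby points. For points that are not close, both remainders are bounded
because \<^term>\<open>S\<close> is compact, and a larger constant covers them. Having the estimates for all
pairs of points spares the later arguments any restriction to nearby points.\<close>

lemma uniform_taylor:
  fixes E :: "'a::euclidean_space \<Rightarrow> real"
  assumes \<Omega>: "open \<Omega>" and C3: "Ck_on 3 E \<Omega>" and S: "compact S" "S \<subseteq> \<Omega>"
  obtains K where "K \<ge> 0"
    "\<And>U. U \<in> S \<Longrightarrow> GDERIV E U :> gradient E U"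
    "\<And>U. U \<in> S \<Longrightarrow> linear (hessian E U)"
    "\<And>U h. U \<in> S \<Longrightarrow> norm (hessian E U h) \<le> K * norm h"
    "\<And>U V. U \<in> S \<Longrightarrow> V \<in> S \<Longrightarrow>
       norm (gradient E V - gradient E U - hessian E U (V - U)) \<le> K * norm (V - U) ^ 2"
    "\<And>U V. U \<in> S \<Longrightarrow> V \<in> S \<Longrightarrow>
       \<bar>E V - E U - inner (gradient E U) (V - U) - 1/2 * inner (hessian E U (V - U)) (V - U)\<bar>
         \<le> K * norm (V - U) ^ 3"
proof -
  define E1 where "E1 b x = frechet_derivative E (at x) b" for b x
  define E2 where "E2 b c x = frechet_derivative (E1 b) (at x) c" for b c x
  define E3 where "E3 b c d x = frechet_derivative (E2 b c) (at x) d" for b c d x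
  have E_diff: "E differentiable at x" and E1_diff: "E1 b differentiable at x"
    and E2_diff: "E2 b c differentiable at x" if "x \<in> \<Omega>" for x b c
    using C3 that unfolding numeral_3_eq_3 Ck_on.simps E1_def E2_def E3_def by auto
  have E3_cont: "continuous_on \<Omega> (E3 b c d)" for b c d
    using C3 unfolding numeral_3_eq_3 Ck_on.simps E1_def E2_def E3_def
    by (cases "\<Omega> = {}") auto
  have grad: "GDERIV E x :> gradient E x" if "x \<in> \<Omega>" for x
    using GDERIV_grad_sum[OF E_diff[OF that]]
    by (simp add: GDERIV_gradient[OF GDERIV_grad_sum[OF E_diff[OF that]]])
  have grad_deriv: "(gradient E has_derivative (\<lambda>h. \<Sum>b\<in>Basis. frechet_derivative (E1 b) (at x) h *\<^sub>R b)) (at x)"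
    if "x \<in> \<Omega>" for x
    using has_derivative_gradient[OF \<Omega> that E_diff] E1_diff[OF that] unfolding E1_def by blast
  then have hess_deriv: "(gradient E has_derivative hessian E x) (at x)" if "x \<in> \<Omega>" for x
    unfolding hessian_def using that
    by (intro iffD1[OF frechet_derivative_works] differentiableI)
  have hess_linear: "linear (hessian E x)" if "x \<in> \<Omega>" for x
    using hess_deriv[OF that] by (rule has_derivative_linear)
  have hess_eq: "hessian E x h = (\<Sum>b\<in>Basis. (\<Sum>c\<in>Basis. (h \<bullet> c) * E2 b c x) *\<^sub>R b)"
    if "x \<in> \<Omega>" for x h
  proof -
    have "hessian E x = (\<lambda>h. \<Sum>b\<in>Basis. frechet_derivative (E1 b) (at x) h *\<^sub>R b)"
      using hess_deriv[OF that] grad_deriv[OF that] by (rule has_derivative_unique)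
    then show ?thesis
      using linear_Basis_expansion[OF linear_frechet_derivative[OF E1_diff[OF that]], of _ h]
      by (simp add: E2_def)
  qed
  define n where "n = real DIM('a)"
  have n: "n > 0"
    by (simp add: n_def)
  have hess_bound: "norm ((\<Sum>b\<in>Basis. (\<Sum>c\<in>Basis. (h \<bullet> c) * a b c) *\<^sub>R b)) \<le> n * n * B * norm h"
    if a: "\<And>b c. b \<in> Basis \<Longrightarrow> c \<in> Basis \<Longrightarrow> \<bar>a b c\<bar> \<le> B" for h :: 'a and a :: "'a \<Rightarrow> 'a \<Rightarrow> real" and B
  proof -
    have "norm ((\<Sum>b\<in>Basis. (\<Sum>c\<in>Basis. (h \<bullet> c) * a b c) *\<^sub>R b))
        \<le> (\<Sum>b\<in>(Basis :: 'a set). n * (B * norm h))"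
    proof (rule sum_norm_le)
      fix b :: 'a
      assume b: "b \<in> Basis"
      have "\<bar>\<Sum>c\<in>Basis. (h \<bullet> c) * a b c\<bar> \<le> (\<Sum>c\<in>(Basis :: 'a set). B * norm h)"
      proof (rule order_trans[OF sum_abs sum_mono])
        fix c :: 'a
        assume "c \<in> Basis"
        then have "\<bar>h \<bullet> c\<bar> * \<bar>a b c\<bar> \<le> norm h * B"
          using a[OF b] by (intro mult_mono) (auto simp: Basis_le_norm)
        then show "\<bar>(h \<bullet> c) * a b c\<bar> \<le> B * norm h"
          by (simp add: abs_mult mult.commute)
      qed
      then show "norm ((\<Sum>c\<in>Basis. (h \<bullet> c) * a b c) *\<^sub>R b) \<le> n * (B * norm h)"
        using b by (simp add: n_def)
    qed
    then show ?thesis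
      by (simp add: n_def mult_ac)
  qed
  obtain \<epsilon> where \<epsilon>: "\<epsilon> > 0" and tube: "(\<Union>x\<in>S. cball x \<epsilon>) \<subseteq> \<Omega>"
    using compact_subset_open_imp_cball_epsilon_subset[OF S(1) \<Omega> S(2)] by blast
  have tubeD: "y \<in> \<Omega>" if "x \<in> S" "y \<in> cball x \<epsilon>" for x y
    using tube that by blast
  \<comment> \<open>A segment between two points of \<^term>\<open>S\<close> may leave \<^term>\<open>S\<close>, but a short one stays in this compact set.\<close>
  define T where "T = {x + y | x y. x \<in> S \<and> y \<in> cball 0 \<epsilon>}"
  have cball_T: "cball x \<epsilon> \<subseteq> T" if "x \<in> S" for x
  proof
    fix y
    assume "y \<in> cball x \<epsilon>"
    then have "y = x + (y - x)" "y - x \<in> cball 0 \<epsilon>"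
      by (auto simp: dist_norm norm_minus_commute)
    then show "y \<in> T"
      unfolding T_def using that by blast
  qed
  have T: "compact T" "T \<subseteq> \<Omega>"
  proof -
    show "compact T"
      unfolding T_def by (intro compact_sums S compact_cball)
    show "T \<subseteq> \<Omega>"
      using tube unfolding T_def by (force simp: dist_norm)
  qed
  have "continuous_on T (\<lambda>x. \<Sum>b\<in>Basis. \<Sum>c\<in>Basis. \<Sum>d\<in>Basis. \<bar>E3 b c d x\<bar>)"
    by (intro continuous_intros continuous_on_subset[OF E3_cont T(2)])
  from continuous_bounded_on_compact[OF T(1) this] obtain B3 where B3: "B3 \<ge> 0"
    "\<And>x. x \<in> T \<Longrightarrow> norm (\<Sum>b\<in>Basis. \<Sum>c\<in>Basis. \<Sum>d\<in>Basis. \<bar>E3 b c d x\<bar>) \<le> B3"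
    by blast
  have "continuous_on \<Omega> (E2 b c)" for b c
    by (intro continuous_on_if_all_differentiable E2_diff)
  then have "continuous_on S (\<lambda>x. \<Sum>b\<in>Basis. \<Sum>c\<in>Basis. \<bar>E2 b c x\<bar>)"
    by (intro continuous_intros continuous_on_subset[OF _ S(2)])
  from continuous_bounded_on_compact[OF S(1) this] obtain B2 where B2: "B2 \<ge> 0"
    "\<And>x. x \<in> S \<Longrightarrow> norm (\<Sum>b\<in>Basis. \<Sum>c\<in>Basis. \<bar>E2 b c x\<bar>) \<le> B2"
    by blast
  have "continuous_on S (gradient E)"
    using hess_deriv S(2) by (blast intro: continuous_on_if_all_differentiable differentiableI)
  from continuous_bounded_on_compact[OF S(1) this] obtain B1 where B1: "B1 \<ge> 0"
    "\<And>x. x \<in> S \<Longrightarrow> norm (gradient E x) \<le> B1"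
    by blast
  have "continuous_on S E"
    using E_diff S(2) by (blast intro: continuous_on_if_all_differentiable)
  from continuous_bounded_on_compact[OF S(1) this] obtain B0 where B0: "B0 \<ge> 0"
    "\<And>x. x \<in> S \<Longrightarrow> norm (E x) \<le> B0"
    by blast
  have E2_lip: "\<bar>E2 b c y - E2 b c x\<bar> \<le> n * B3 * norm (y - x)"
    if b: "b \<in> Basis" and c: "c \<in> Basis" and x: "x \<in> S" and y: "y \<in> cball x \<epsilon>" for b c x y
  proof -
    have "norm (E2 b c y - E2 b c x) \<le> (n * B3) * norm (y - x)"
    proof (rule differentiable_bound[where S = "cball x \<epsilon>" and f' = "\<lambda>z. frechet_derivative (E2 b c) (at z)"])
      fix z
      assume "z \<in> cball x \<epsilon>"
      then have z: "z \<in> T" "z \<in> \<Omega>"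
        using cball_T[OF x] T by auto
      show "(E2 b c has_derivative frechet_derivative (E2 b c) (at z)) (at z within cball x \<epsilon>)"
        using E2_diff[OF z(2)] by (simp add: frechet_derivative_works has_derivative_at_withinI)
      have "\<bar>frechet_derivative (E2 b c) (at z) h\<bar> \<le> n * B3 * norm h" for h
      proof -
        have "\<bar>E3 b c d z\<bar> \<le> B3" if d: "d \<in> Basis" for d
        proof -
          have "\<bar>E3 b c d z\<bar> \<le> (\<Sum>d\<in>Basis. \<bar>E3 b c d z\<bar>)"
            by (rule member_le_sum[OF d]) auto
          also have "\<dots> \<le> (\<Sum>c\<in>Basis. \<Sum>d\<in>Basis. \<bar>E3 b c d z\<bar>)"
            by (rule member_le_sum[OF c, of "\<lambda>c. \<Sum>d\<in>Basis. \<bar>E3 b c d z\<bar>"]) (auto intro: sum_nonneg)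
          also have "\<dots> \<le> (\<Sum>b\<in>Basis. \<Sum>c\<in>Basis. \<Sum>d\<in>Basis. \<bar>E3 b c d z\<bar>)"
            by (rule member_le_sum[OF b, of "\<lambda>b. \<Sum>c\<in>Basis. \<Sum>d\<in>Basis. \<bar>E3 b c d z\<bar>"])
              (auto intro: sum_nonneg)
          also have "\<dots> \<le> B3"
            using B3(2)[OF z(1)] by simp
          finally show ?thesis .
        qed
        then have summand: "\<bar>(h \<bullet> d) * E3 b c d z\<bar> \<le> norm h * B3" if "d \<in> Basis" for d
          unfolding abs_mult using that by (intro mult_mono) (auto simp: Basis_le_norm)
        have "\<bar>frechet_derivative (E2 b c) (at z) h\<bar> = \<bar>\<Sum>d\<in>Basis. (h \<bullet> d) * E3 b c d z\<bar>"
          using linear_Basis_expansion[OF linear_frechet_derivative[OF E2_diff[OF z(2)]], of b c h]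
          by (simp add: E3_def)
        also have "\<dots> \<le> (\<Sum>d\<in>(Basis :: 'a set). norm h * B3)"
          by (rule order_trans[OF sum_abs sum_mono]) (rule summand)
        finally show ?thesis
          by (simp add: n_def mult_ac)
      qed
      then show "onorm (frechet_derivative (E2 b c) (at z)) \<le> n * B3"
        by (intro onorm_le) simp
    qed (use y \<epsilon> in auto)
    then show ?thesis by simp
  qed
  define K1 where "K1 = n * n * (n * B3 * 1)"
  have K1: "K1 \<ge> 0"
    using n B3 by (simp add: K1_def)
  have hess_lip: "norm (hessian E y h - hessian E x h) \<le> K1 * norm (y - x) * norm h"
    if x: "x \<in> S" and y: "y \<in> cball x \<epsilon>" for x y h
  proof -
    have "y \<in> \<Omega>" "x \<in> \<Omega>"
      using tubeD[OF x y] x S by auto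
    then have "hessian E y h - hessian E x h
        = (\<Sum>b\<in>Basis. (\<Sum>c\<in>Basis. (h \<bullet> c) * (E2 b c y - E2 b c x)) *\<^sub>R b)"
      by (simp add: hess_eq sum_subtractf algebra_simps)
    also have "norm \<dots> \<le> n * n * (n * B3 * norm (y - x)) * norm h"
      by (intro hess_bound E2_lip x y)
    finally show ?thesis
      by (simp add: K1_def mult_ac)
  qed
  have hess_norm: "norm (hessian E x h) \<le> n * n * B2 * norm h" if x: "x \<in> S" for x h
  proof -
    have "\<bar>E2 b c x\<bar> \<le> B2" if b: "b \<in> Basis" and c: "c \<in> Basis" for b c
    proof -
      have "\<bar>E2 b c x\<bar> \<le> (\<Sum>c\<in>Basis. \<bar>E2 b c x\<bar>)"
        by (rule member_le_sum[OF c, of "\<lambda>c. \<bar>E2 b c x\<bar>"]) auto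
      also have "\<dots> \<le> (\<Sum>b\<in>Basis. \<Sum>c\<in>Basis. \<bar>E2 b c x\<bar>)"
        by (rule member_le_sum[OF b, of "\<lambda>b. \<Sum>c\<in>Basis. \<bar>E2 b c x\<bar>"]) (auto intro: sum_nonneg)
      also have "\<dots> \<le> B2"
        using B2(2)[OF x] by simp
      finally show ?thesis .
    qed
    moreover have "x \<in> \<Omega>" using x S by auto
    ultimately show ?thesis
      by (simp add: hess_eq hess_bound)
  qed
  have segment: "U + s *\<^sub>R (V - U) \<in> cball U \<epsilon>" if "norm (V - U) \<le> \<epsilon>" "0 \<le> s" "s \<le> 1" for U V s
  proof -
    have "s * norm (V - U) \<le> 1 * \<epsilon>"
      using that by (intro mult_mono) auto
    then show ?thesis
      using that by (simp add: dist_norm)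
  qed
  have grad_local: "norm (gradient E y - gradient E U - hessian E U (y - U)) \<le> K1 * norm (y - U) ^ 2"
    if U: "U \<in> S" and y: "y \<in> cball U \<epsilon>" for U y
  proof -
    let ?r = "norm (y - U)"
    have r: "cball U ?r \<subseteq> cball U \<epsilon>"
      using y by (auto simp: dist_norm norm_minus_commute)
    have "norm (gradient E y - gradient E U - hessian E U (y - U)) \<le> norm (y - U) * (K1 * ?r)"
    proof (rule differentiable_bound_linearization[where S = "cball U ?r"
          and f' = "hessian E"])
      show "U + t *\<^sub>R (y - U) \<in> cball U ?r" if "t \<in> {0..1}" for t
        using that by (auto simp: dist_norm mult_left_le_one_le)
      fix x
      assume x: "x \<in> cball U ?r"
      have xo: "x \<in> \<Omega>"
        using subsetD[OF r x] by (rule tubeD[OF U])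
      show "(gradient E has_derivative hessian E x) (at x within cball U ?r)"
        by (rule has_derivative_at_withinI[OF hess_deriv[OF xo]])
      have "norm ((hessian E x - hessian E U) h) \<le> K1 * ?r * norm h" for h
      proof -
        have "norm (hessian E x h - hessian E U h) \<le> K1 * norm (x - U) * norm h"
          using subsetD[OF r x] by (rule hess_lip[OF U])
        also have "\<dots> \<le> K1 * ?r * norm h"
          using x K1
          by (intro mult_right_mono mult_left_mono) (simp_all add: dist_norm norm_minus_commute)
        finally show ?thesis by simp
      qed
      then show "onorm (hessian E x - hessian E U) \<le> K1 * ?r"
        by (rule onorm_le)
    qed simp
    then show ?thesis
      by (simp add: power2_eq_square mult_ac)
  qed
  have energy_local: "\<bar>E V - E U - inner (gradient E U) (V - U) - 1/2 * inner (hessian E U (V - U)) (V - U)\<bar>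
         \<le> K1 * norm (V - U) ^ 3" if U: "U \<in> S" and V: "norm (V - U) \<le> \<epsilon>" for U V
  proof -
    define \<Delta> where "\<Delta> = V - U"
    define \<phi> where "\<phi> s = E (U + s *\<^sub>R \<Delta>) - s * inner (gradient E U) \<Delta>
        - s\<^sup>2 / 2 * inner (hessian E U \<Delta>) \<Delta>" for s
    have lin: "linear (hessian E U)"
      using hess_linear U S by auto
    have "norm (\<phi> 1 - \<phi> 0) \<le> K1 * norm \<Delta> ^ 3 * norm (1 - 0 :: real)"
    proof (rule field_differentiable_bound[where S = "{0..1}"])
      fix s :: real
      assume "s \<in> {0..1}"
      then have s: "0 \<le> s" "s \<le> 1" by auto
      let ?y = "U + s *\<^sub>R \<Delta>"
      let ?\<phi>' = "inner (gradient E ?y - gradient E U - hessian E U (s *\<^sub>R \<Delta>)) \<Delta>"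
      have y: "?y \<in> cball U \<epsilon>"
        unfolding \<Delta>_def by (rule segment[OF V s])
      then have "?y \<in> \<Omega>"
        by (rule tubeD[OF U])
      then have "(E has_derivative (\<lambda>h. inner h (gradient E ?y))) (at ?y)"
        using grad by (simp add: gderiv_def)
      then have "((\<lambda>s. E (U + s *\<^sub>R \<Delta>)) has_derivative (\<lambda>h. inner (h *\<^sub>R \<Delta>) (gradient E ?y))) (at s)"
        by (rule has_derivative_compose[rotated]) (auto intro!: derivative_eq_intros)
      then have "((\<lambda>s. E (U + s *\<^sub>R \<Delta>)) has_real_derivative inner (gradient E ?y) \<Delta>) (at s)"
        by (simp add: has_field_derivative_def inner_commute mult_commute_abs)
      then have "(\<phi> has_real_derivative (inner (gradient E ?y) \<Delta> - inner (gradient E U) \<Delta>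
          - s * inner (hessian E U \<Delta>) \<Delta>)) (at s)"
        unfolding \<phi>_def[abs_def] by (auto intro!: derivative_eq_intros)
      then show "(\<phi> has_field_derivative ?\<phi>') (at s within {0..1})"
        by (rule has_field_derivative_at_within[OF DERIV_cong])
          (simp add: inner_diff_left linear_scale[OF lin])
      have "norm ?\<phi>' \<le> norm (gradient E ?y - gradient E U - hessian E U (s *\<^sub>R \<Delta>)) * norm \<Delta>"
        by (simp add: Cauchy_Schwarz_ineq2)
      also have "\<dots> \<le> (K1 * norm (s *\<^sub>R \<Delta>) ^ 2) * norm \<Delta>"
        using grad_local[OF U y] by (intro mult_right_mono) auto
      also have "\<dots> \<le> (K1 * norm \<Delta> ^ 2) * norm \<Delta>"
        using s K1 by (intro mult_right_mono mult_left_mono power_mono) (auto simp: mult_left_le_one_le)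
      finally show "norm ?\<phi>' \<le> K1 * norm \<Delta> ^ 3"
        by (simp add: power2_eq_square power3_eq_cube mult_ac)
    qed auto
    then show ?thesis
      by (simp add: \<phi>_def \<Delta>_def)
  qed
  \<comment> \<open>\<open>K\<close> dominates both the constant for pairs at distance at most \<open>\<epsilon>\<close> and the crude bounds for the others.\<close>
  define H where "H = n * n * B2"
  have H: "H \<ge> 0"
    using n B2 by (simp add: H_def)
  define K where "K = K1 + H + (2 * B1 / \<epsilon> ^ 2 + H / \<epsilon> ^ 1)
      + (2 * B0 / \<epsilon> ^ 3 + B1 / \<epsilon> ^ 2 + H / \<epsilon> ^ 1)"
  have K: "K \<ge> K1" "K \<ge> H" "K \<ge> 2 * B1 / \<epsilon> ^ 2 + H / \<epsilon> ^ 1"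
    "K \<ge> 2 * B0 / \<epsilon> ^ 3 + B1 / \<epsilon> ^ 2 + H / \<epsilon> ^ 1"
  proof -
    have "0 \<le> 2 * B1 / \<epsilon> ^ 2" "0 \<le> 2 * B0 / \<epsilon> ^ 3" "0 \<le> B1 / \<epsilon> ^ 2" "0 \<le> H / \<epsilon> ^ 1"
      using H B0(1) B1(1) \<epsilon> by simp_all
    then show "K \<ge> K1" "K \<ge> H" "K \<ge> 2 * B1 / \<epsilon> ^ 2 + H / \<epsilon> ^ 1"
      "K \<ge> 2 * B0 / \<epsilon> ^ 3 + B1 / \<epsilon> ^ 2 + H / \<epsilon> ^ 1"
      unfolding K_def using K1 H by linarith+
  qed
  show ?thesis
  proof (rule that)
    show "K \<ge> 0"
      using K K1 by simp
    fix U
    assume U: "U \<in> S"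
    show "GDERIV E U :> gradient E U" "linear (hessian E U)"
      using U S grad hess_linear by auto
    show "norm (hessian E U h) \<le> K * norm h" for h
      using hess_norm[OF U, of h] mult_right_mono[OF K(2), of "norm h"] by (simp add: H_def)
    fix V
    assume V: "V \<in> S"
    let ?d = "norm (V - U)"
    have big: "a * ?d ^ m \<le> a / \<epsilon> ^ k * ?d ^ (m + k)" if "\<epsilon> < ?d" "a \<ge> 0" for a k m
      using dominated_by_power[of a \<epsilon> ?d] that \<epsilon> by simp
    show "norm (gradient E V - gradient E U - hessian E U (V - U)) \<le> K * ?d ^ 2"
    proof (cases "?d \<le> \<epsilon>")
      case True
      then have "norm (gradient E V - gradient E U - hessian E U (V - U)) \<le> K1 * ?d ^ 2"
        using U by (intro grad_local) (auto simp: dist_norm norm_minus_commute)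
      also have "\<dots> \<le> K * ?d ^ 2"
        using K by (intro mult_right_mono) auto
      finally show ?thesis .
    next
      case False
      have "norm (gradient E V - gradient E U - hessian E U (V - U))
          \<le> norm (gradient E V) + norm (gradient E U) + norm (hessian E U (V - U))"
        using norm_triangle_ineq4[of "gradient E V - gradient E U" "hessian E U (V - U)"]
          norm_triangle_ineq4[of "gradient E V" "gradient E U"] by linarith
      also have "\<dots> \<le> 2 * B1 * ?d ^ 0 + H * ?d ^ 1"
        using B1(2)[OF U] B1(2)[OF V] hess_norm[OF U, of "V - U"] by (simp add: H_def)
      also have "\<dots> \<le> 2 * B1 / \<epsilon> ^ 2 * ?d ^ 2 + H / \<epsilon> ^ 1 * ?d ^ 2"
        using False B1 H big[of "2 * B1" 0 2] big[of H 1 1] by (simp add: numeral_2_eq_2)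
      also have "\<dots> \<le> K * ?d ^ 2"
        using mult_right_mono[OF K(3), of "?d ^ 2"] by (simp add: distrib_right)
      finally show ?thesis .
    qed
    show "\<bar>E V - E U - inner (gradient E U) (V - U) - 1/2 * inner (hessian E U (V - U)) (V - U)\<bar>
         \<le> K * ?d ^ 3"
    proof (cases "?d \<le> \<epsilon>")
      case True
      from energy_local[OF U this]
      show ?thesis
        using mult_right_mono[OF K(1), of "?d ^ 3"] by simp
    next
      case False
      have "\<bar>inner (gradient E U) (V - U)\<bar> \<le> B1 * ?d"
        using Cauchy_Schwarz_ineq2[of "gradient E U" "V - U"] mult_right_mono[OF B1(2)[OF U], of ?d] by simp
      moreover have "\<bar>inner (hessian E U (V - U)) (V - U)\<bar> \<le> H * ?d ^ 2"
        using Cauchy_Schwarz_ineq2[of "hessian E U (V - U)" "V - U"]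
          mult_right_mono[OF hess_norm[OF U, of "V - U"], of ?d]
        by (simp add: H_def power2_eq_square mult_ac)
      moreover have "\<bar>E U\<bar> \<le> B0" "\<bar>E V\<bar> \<le> B0"
        using B0(2)[OF U] B0(2)[OF V] by auto
      ultimately have "\<bar>E V - E U - inner (gradient E U) (V - U) - 1/2 * inner (hessian E U (V - U)) (V - U)\<bar>
          \<le> 2 * B0 * ?d ^ 0 + B1 * ?d ^ 1 + H * ?d ^ 2"
        by simp
      also have "\<dots> \<le> 2 * B0 / \<epsilon> ^ 3 * ?d ^ 3 + B1 / \<epsilon> ^ 2 * ?d ^ 3 + H / \<epsilon> ^ 1 * ?d ^ 3"
        using False B0 B1 H big[of "2 * B0" 0 3] big[of B1 1 2] big[of H 2 1]
        by (simp add: eval_nat_numeral)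
      also have "\<dots> \<le> K * ?d ^ 3"
        using mult_right_mono[OF K(4), of "?d ^ 3"] by (simp add: distrib_right)
      finally show ?thesis .
    qed
  qed
qed

section \<open>Invariant energies to second order\<close>

lemma abs_inner_le: "norm x \<le> a \<Longrightarrow> norm y \<le> b \<Longrightarrow> \<bar>inner x y\<bar> \<le> a * b"
  by (rule order_trans[OF Cauchy_Schwarz_ineq2]) (auto intro!: mult_mono intro: order_trans[OF norm_ge_zero])

text \<open>If \<open>U\<^sup>T V\<close> is symmetric, so is \<open>U\<^sup>T (V - U)\<close>, and then it equals minus one half of the
Gram matrix of \<open>V - U\<close>.\<close>

lemma norm_symmetric_offset_le:
  assumes U: "U \<in> stiefel" and V: "V \<in> stiefel"
    and sym: "transpose (transpose U ** V) = transpose U ** V"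
  shows "norm (transpose U ** (V - U)) \<le> 1/2 * (norm (V - U))\<^sup>2"
proof -
  let ?X = "transpose U ** (V - U)"
  have "transpose ?X = ?X"
    using sym by (simp add: matrix_mult.diff_right stiefelD[OF U] transpose_diff)
  then have "?X + ?X = - (transpose (V - U) ** (V - U))"
    using stiefel_diff[OF U V] by simp
  then have "norm (?X + ?X) \<le> norm (V - U) * norm (V - U)"
    using norm_matrix_mult_le[of "transpose (V - U)" "V - U"] by (simp add: norm_transpose)
  moreover have "norm (?X + ?X) = 2 * norm ?X"
    by (metis norm_scaleR scaleR_2 abs_numeral)
  ultimately show ?thesis
    by (simp add: power2_eq_square)
qed

text \<open>A smooth function on the Stiefel manifold that depends only on the class of its argument. The
constant \<^term>\<open>K\<close> is the one of the uniform Taylor estimates.\<close>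

locale grassmann_energy =
  fixes E :: "real^'k^'g \<Rightarrow> real" and K C0 L0 :: real
  assumes invariant: "orthogonal_matrix P \<Longrightarrow> E (U ** P) = E U"
    and gderiv: "U \<in> stiefel \<Longrightarrow> GDERIV E U :> gradient E U"
    and hess_linear: "U \<in> stiefel \<Longrightarrow> linear (hessian E U)"
    and K_nonneg: "K \<ge> 0"
    and hess_le: "U \<in> stiefel \<Longrightarrow> norm (hessian E U X) \<le> K * norm X"
    and grad_taylor: "U \<in> stiefel \<Longrightarrow> V \<in> stiefel \<Longrightarrow>
      norm (gradient E V - gradient E U - hessian E U (V - U)) \<le> K * norm (V - U) ^ 2"
    and energy_taylor: "U \<in> stiefel \<Longrightarrow> V \<in> stiefel \<Longrightarrow>
      \<bar>E V - E U - inner (gradient E U) (V - U) - 1/2 * inner (hessian E U (V - U)) (V - U)\<bar>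
        \<le> K * norm (V - U) ^ 3"
    and C0_pos: "C0 > 0"
    and grad_le: "U \<in> stiefel \<Longrightarrow> norm (gradient E U) \<le> C0"
    and L0_pos: "L0 > 0"
    and grad_lipschitz: "U \<in> stiefel \<Longrightarrow> V \<in> stiefel \<Longrightarrow>
      norm (gradient E U - gradient E V) \<le> L0 * norm (U - V)"
begin

text \<open>\<open>M\<close> bounds the Riemannian Hessian, and \<open>lip\<close> is a Lipschitz constant of the
Riemannian gradient.\<close>

definition "M = K + C0"

lemma M_pos: "M > 0"
  using K_nonneg C0_pos by (simp add: M_def)

definition "lip = L0 + 2 * C0"

lemma lip_pos: "lip > 0"
  using L0_pos C0_pos by (simp add: lip_def)

text \<open>Invariance makes \<^term>\<open>E\<close> constant along \<open>U R(t)\<close> for every curve of rotations, so the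
gradient is orthogonal to \<open>U B\<close> for skew \<open>B\<close>. Equivalently \<open>U\<^sup>T \<nabla>E(U)\<close>, the
Lagrange multiplier of the orthonormality constraint, is symmetric.\<close>

lemma symmetric_multiplier:
  assumes U: "U \<in> stiefel"
  shows "transpose (transpose U ** gradient E U) = transpose U ** gradient E U"
proof -
  let ?N = "transpose U ** gradient E U"
  have "?N $ i $ j = ?N $ j $ i" for i j
  proof (cases "i = j")
    case False
    let ?B = "skew_unit i j"
    have "((\<lambda>t. U ** skew_rotation ?B t) has_vector_derivative U ** ?B) (at 0)"
      by (rule bounded_linear.has_vector_derivative[OF matrix_mult.bounded_linear_right
            has_vector_derivative_skew_rotation])
    then have "((\<lambda>t. U ** skew_rotation ?B t) has_derivative (\<lambda>t. t *\<^sub>R (U ** ?B))) (at 0)"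
      by (simp add: has_vector_derivative_def)
    moreover have "(E has_derivative (\<lambda>h. inner h (gradient E U))) (at (U ** skew_rotation ?B 0))"
      using gderiv[OF U] by (simp add: gderiv_def skew_rotation_0)
    ultimately have "((\<lambda>t. E (U ** skew_rotation ?B t)) has_derivative
        (\<lambda>t. inner (t *\<^sub>R (U ** ?B)) (gradient E U))) (at 0)"
      by (rule has_derivative_compose)
    moreover have "(\<lambda>t. E (U ** skew_rotation ?B t)) = (\<lambda>t. E U)"
      by (intro ext invariant orthogonal_skew_rotation skew_unit False)
    ultimately have "(\<lambda>t. inner (t *\<^sub>R (U ** ?B)) (gradient E U)) = (\<lambda>t. 0)"
      using has_derivative_unique[OF _ has_derivative_const] by metis
    from fun_cong[OF this, of 1] have "inner (U ** ?B) (gradient E U) = 0"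
      by simp
    then have "inner ?N ?B = 0"
      unfolding inner_commute[of _ "?B"] inner_matrix_mult_left .
    then show ?thesis
      by (simp add: inner_skew_unit)
  qed simp
  then show ?thesis
    by (simp add: vec_eq_iff transpose_def)
qed

lemma norm_multiplier_le: "U \<in> stiefel \<Longrightarrow> norm (transpose U ** gradient E U) \<le> C0"
  using norm_stiefel_transpose_mult_le grad_le order_trans by blast

lemma grad_G_eq: "grad_G E U = horizontal U (gradient E U)"
  by (simp add: grad_G_def horizontal_def)

lemma grad_G_tangent: "U \<in> stiefel \<Longrightarrow> grad_G E U \<in> tangent U"
  by (simp add: grad_G_eq horizontal_tangent)

lemma norm_grad_G_le: "U \<in> stiefel \<Longrightarrow> norm (grad_G E U) \<le> C0"
  unfolding grad_G_eq using norm_horizontal_le grad_le order_trans by blast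

text \<open>The second derivative of the Lagrangian of the constraint. Its horizontal part on tangent vectors is
the Riemannian Hessian, but it is defined, and linear, on all displacements.\<close>

definition curvature :: "real^'k^'g \<Rightarrow> real^'k^'g \<Rightarrow> real^'k^'g" where
  "curvature U X = hessian E U X - X ** (transpose U ** gradient E U)"

lemma linear_curvature:
  assumes "U \<in> stiefel"
  shows "linear (curvature U)"
  unfolding curvature_def[abs_def]
  by (intro linear_compose_sub hess_linear assms bounded_linear.linear[OF matrix_mult.bounded_linear_left])

lemma norm_curvature_le:
  assumes U: "U \<in> stiefel"
  shows "norm (curvature U X) \<le> M * norm X"
proof -
  have "norm (X ** (transpose U ** gradient E U)) \<le> norm X * C0"
    by (rule order_trans[OF norm_matrix_mult_le]) (intro mult_left_mono norm_multiplier_le U norm_ge_zero)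
  then show ?thesis
    using hess_le[OF U, of X] norm_triangle_ineq4[of "hessian E U X" "X ** (transpose U ** gradient E U)"]
    by (simp add: curvature_def M_def algebra_simps)
qed

lemma tangent_mult: "D \<in> tangent U \<Longrightarrow> D ** Y \<in> tangent U"
  by (simp add: tangent_iff matrix_mul_assoc)

lemma hess_G_eq:
  assumes "D \<in> tangent U"
  shows "hess_G E U D = horizontal U (curvature U D)"
proof -
  have "horizontal U (D ** (transpose U ** gradient E U)) = D ** (transpose U ** gradient E U)"
    by (intro horizontal_ident tangent_mult assms)
  then show ?thesis
    by (simp add: curvature_def horizontal_diff) (simp add: hess_G_def horizontal_def matrix_mul_assoc)
qed

lemma hess_G2_eq:
  assumes "D \<in> tangent U"
  shows "hess_G2 E U D D = inner (curvature U D) D"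
  using assms by (simp add: hess_G2_def hess_G_eq inner_horizontal_commute horizontal_ident)

lemma norm_hess_G_le:
  assumes "U \<in> stiefel" "D \<in> tangent U"
  shows "norm (hess_G E U D) \<le> M * norm D"
  unfolding hess_G_eq[OF assms(2)]
  using norm_horizontal_le[OF assms(1)] norm_curvature_le[OF assms(1)] order_trans by blast

lemma hess_G2_le:
  assumes "U \<in> stiefel" "D \<in> tangent U"
  shows "hess_G2 E U D D \<le> M * (norm D)\<^sup>2"
  using abs_inner_le[OF norm_hess_G_le[OF assms] order_refl[of "norm D"]]
  by (simp add: hess_G2_def power2_eq_square mult.assoc)

lemma hess_G_diff:
  assumes "U \<in> stiefel" "D \<in> tangent U" "D' \<in> tangent U"
  shows "hess_G E U (D - D') = hess_G E U D - hess_G E U D'"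
proof -
  have "D - D' \<in> tangent U"
    using assms by (simp add: tangent_iff matrix_mult.diff_right)
  then show ?thesis
    using assms by (simp add: hess_G_eq linear_diff[OF linear_curvature] horizontal_diff)
qed

text \<open>The vertical part of the gradient is \<open>U N\<close> with the symmetric multiplier
\<open>N = U\<^sup>T \<nabla>E(U)\<close>, so it sees only the symmetric part of \<open>U\<^sup>T (V - U)\<close>, which is
minus one half of a Gram matrix. Thus the vertical first-order term of the Euclidean expansion
turns into the curvature correction.\<close>

lemma energy_expansion:
  assumes U: "U \<in> stiefel" and V: "V \<in> stiefel"
  shows "\<bar>E V - E U - inner (grad_G E U) (V - U) - 1/2 * inner (curvature U (V - U)) (V - U)\<bar>
    \<le> K * norm (V - U) ^ 3"
proof -
  let ?\<Delta> = "V - U" and ?N = "transpose U ** gradient E U"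
  let ?X = "transpose U ** (V - U)"
  have "inner ?N (transpose ?X) = inner ?N ?X"
    using inner_transpose[of ?N "transpose ?X"] by (simp add: symmetric_multiplier[OF U])
  then have "2 * inner ?N ?X = inner ?N (?X + transpose ?X)"
    by (simp add: inner_add_right)
  also have "\<dots> = - inner ?N (transpose ?\<Delta> ** ?\<Delta>)"
    unfolding stiefel_diff[OF U V] by simp
  also have "inner ?N (transpose ?\<Delta> ** ?\<Delta>) = inner (?\<Delta> ** ?N) ?\<Delta>"
    by (simp only: inner_matrix_mult_left)
  finally have normal: "inner ?N ?X = - (1/2 * inner (?\<Delta> ** ?N) ?\<Delta>)"
    by simp
  have "gradient E U = grad_G E U + U ** ?N"
    by (simp add: grad_G_eq horizontal_eq)
  then have "inner (gradient E U) ?\<Delta> = inner (grad_G E U) ?\<Delta> + inner ?N ?X"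
    by (metis inner_add_left inner_matrix_mult_left)
  then have "inner (gradient E U) ?\<Delta> + 1/2 * inner (hessian E U ?\<Delta>) ?\<Delta>
      = inner (grad_G E U) ?\<Delta> + 1/2 * inner (curvature U ?\<Delta>) ?\<Delta>"
    unfolding normal by (simp add: curvature_def inner_diff_left)
  then show ?thesis
    using energy_taylor[OF U V] by (smt (verit))
qed

text \<open>The displacement is compared with a tangent vector. As the first-order term only involves the
Riemannian gradient, a quadratically small remainder \<^term>\<open>R\<close> costs the size of that gradient
times \<open>\<parallel>R\<parallel>\<close>, which is of third order whenever the gradient is of the order of the step.\<close>

lemma energy_along_tangent:
  fixes D :: "real^'k^'g"
  assumes U: "U \<in> stiefel" and V: "V \<in> stiefel" and D: "D \<in> tangent U" and t: "t \<ge> 0"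
  defines "R \<equiv> V - U - t *\<^sub>R D"
  shows "\<bar>E V - E U - t * inner (grad_G E U) D - t\<^sup>2 / 2 * hess_G2 E U D D\<bar>
    \<le> (norm (grad_G E U) + M / 2 * (norm (V - U) + t * norm D)) * norm R + K * norm (V - U) ^ 3"
proof -
  let ?\<Delta> = "V - U" and ?g = "grad_G E U"
  have \<Delta>: "?\<Delta> = t *\<^sub>R D + R"
    by (simp add: R_def)
  note lin = linear_curvature[OF U]
  have 1: "inner ?g ?\<Delta> = t * inner ?g D + inner ?g R"
    by (simp add: \<Delta> inner_add_right)
  have "inner (curvature U ?\<Delta>) ?\<Delta> = inner (curvature U ?\<Delta>) (t *\<^sub>R D) + inner (curvature U ?\<Delta>) R"
    by (simp add: \<Delta> inner_add_right)
  also have "inner (curvature U ?\<Delta>) (t *\<^sub>R D) = t\<^sup>2 * hess_G2 E U D D + t * inner (curvature U R) D"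
    by (simp add: \<Delta> linear_add[OF lin] linear_scale[OF lin] hess_G2_eq[OF D] inner_add_left
        algebra_simps power2_eq_square)
  finally have 2: "inner (curvature U ?\<Delta>) ?\<Delta>
    = t\<^sup>2 * hess_G2 E U D D + t * inner (curvature U R) D + inner (curvature U ?\<Delta>) R" .
  have b1: "\<bar>inner ?g R\<bar> \<le> norm ?g * norm R"
    by (rule Cauchy_Schwarz_ineq2)
  have b2: "\<bar>t * inner (curvature U R) D\<bar> \<le> t * (M * norm R * norm D)"
    using t abs_inner_le[OF norm_curvature_le[OF U, of R] order_refl[of "norm D"]]
    by (simp add: abs_mult mult_left_mono)
  have b3: "\<bar>inner (curvature U ?\<Delta>) R\<bar> \<le> M * norm ?\<Delta> * norm R"
    by (rule abs_inner_le[OF norm_curvature_le[OF U]]) simp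
  have "(norm ?g + M / 2 * (norm ?\<Delta> + t * norm D)) * norm R
    = norm ?g * norm R + 1/2 * (t * (M * norm R * norm D)) + 1/2 * (M * norm ?\<Delta> * norm R)"
    by (simp add: algebra_simps)
  moreover have "E V - E U - t * inner ?g D - t\<^sup>2 / 2 * hess_G2 E U D D
    = (E V - E U - inner ?g ?\<Delta> - 1/2 * inner (curvature U ?\<Delta>) ?\<Delta>)
      + inner ?g R + 1/2 * (t * inner (curvature U R) D) + 1/2 * inner (curvature U ?\<Delta>) R"
    unfolding 1 2 by (simp add: algebra_simps)
  ultimately show ?thesis
    using energy_expansion[OF U V] b1 b2 b3 by linarith
qed

text \<open>Aligning a nearby \<^term>\<open>W\<close> with \<^term>\<open>V\<close> makes the displacement horizontal up to second
order, so coercivity on horizontal vectors dominates the cubic remainder.\<close>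

lemma second_order_sufficient:
  assumes V: "V \<in> stiefel" and crit: "grad_G E V = 0" and \<nu>: "\<nu> > 0"
    and coercive: "\<And>D. D \<in> tangent V \<Longrightarrow> \<nu> * (norm D)\<^sup>2 \<le> hess_G2 E V D D"
  shows "local_minimizer E V"
proof -
  \<comment> \<open>At distance \<open>d \<le> 1\<close> the energy grows by at least \<open>d\<^sup>2 (\<nu> - d (\<nu> + M + 2 K)) / 2\<close>.\<close>
  define \<epsilon> where "\<epsilon> = min 1 (\<nu> / (\<nu> + M + 2 * K))"
  have den: "\<nu> + M + 2 * K > 0"
    using \<nu> M_pos K_nonneg by simp
  then have \<epsilon>: "\<epsilon> > 0" "\<epsilon> \<le> 1" "\<epsilon> * (\<nu> + M + 2 * K) \<le> \<nu>"
    using \<nu> by (auto simp: \<epsilon>_def min_mult_distrib_right)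
  have "E V \<le> E W" if W: "W \<in> stiefel" and near: "cls W \<in> gr_ball V \<epsilon>" for W
  proof -
    obtain P where P: "orthogonal_matrix P" "dist_F W V = norm (W - V ** P)"
      and sym: "transpose (transpose V ** (W ** transpose P)) = transpose V ** (W ** transpose P)"
      using aligned_representative[OF W V] by metis
    define W' where "W' = W ** transpose P"
    have P': "orthogonal_matrix (transpose P)"
      using P by (simp add: orthogonal_matrix_transpose)
    have W': "W' \<in> stiefel" "E W' = E W"
      unfolding W'_def by (auto intro: stiefel_mult_orthogonal W P' invariant)
    have "W' - V = (W - V ** P) ** transpose P"
      using P by (simp add: W'_def matrix_mult.diff_left orthogonal_matrix_mult_transpose flip: matrix_mul_assoc)
    then have d: "norm (W' - V) \<le> \<epsilon>"
      using near by (simp add: norm_mult_orthogonal[OF P'] P gr_ball_iff[OF W V])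
    define d where "d = norm (W' - V)"
    define D where "D = horizontal V (W' - V)"
    have D: "D \<in> tangent V" "norm D \<le> d"
      by (simp_all add: D_def d_def horizontal_tangent norm_horizontal_le V)
    have X: "norm (transpose V ** (W' - V)) \<le> 1/2 * d\<^sup>2"
      using norm_symmetric_offset_le[OF V W'(1)] sym by (simp add: d_def W'_def)
    have R: "norm (W' - V - 1 *\<^sub>R D) \<le> 1/2 * d\<^sup>2"
      using X by (simp add: D_def horizontal_eq norm_stiefel_mult[OF V])
    have d01: "0 \<le> d" "d \<le> 1"
      using d \<epsilon> by (auto simp: d_def)
    have "d\<^sup>2 - (norm D)\<^sup>2 = (norm (transpose V ** (W' - V)))\<^sup>2"
      unfolding D_def d_def using norm_sq_horizontal[OF V, of "W' - V"] by simp
    also have "\<dots> \<le> (1/2 * d\<^sup>2)\<^sup>2"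
      by (intro power_mono X) simp
    also have "\<dots> = d ^ 4 / 4"
      by (simp add: power_mult_distrib power_divide flip: power_mult)
    also have "\<dots> \<le> d ^ 3"
      using d01 power_decreasing[of 3 4 d] zero_le_power[OF d01(1), of 3] by linarith
    finally have Dd: "(norm D)\<^sup>2 \<ge> d\<^sup>2 - d ^ 3" by simp
    have "(M / 2 * (d + 1 * norm D)) * norm (W' - V - 1 *\<^sub>R D) \<le> (M / 2 * (d + d)) * (1/2 * d\<^sup>2)"
      using M_pos D R d01 by (intro mult_mono) auto
    also have "\<dots> = M / 2 * d ^ 3"
      by (simp add: power2_eq_square power3_eq_cube)
    finally have "(M / 2 * (d + 1 * norm D)) * norm (W' - V - 1 *\<^sub>R D) \<le> M / 2 * d ^ 3" .
    moreover have "\<bar>E W' - E V - 1 * inner (grad_G E V) D - 1\<^sup>2 / 2 * hess_G2 E V D D\<bar>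
      \<le> (norm (grad_G E V) + M / 2 * (d + 1 * norm D)) * norm (W' - V - 1 *\<^sub>R D) + K * d ^ 3"
      unfolding d_def by (rule energy_along_tangent[OF V W'(1) D(1)]) simp
    ultimately have "E W' - E V \<ge> 1/2 * hess_G2 E V D D - (M / 2 * d ^ 3 + K * d ^ 3)"
      unfolding crit by simp
    moreover have "\<nu> * (d\<^sup>2 - d ^ 3) \<le> \<nu> * (norm D)\<^sup>2"
      using Dd \<nu> by simp
    ultimately have "E W' - E V \<ge> 1/2 * (\<nu> * (d\<^sup>2 - d ^ 3)) - (M / 2 * d ^ 3 + K * d ^ 3)"
      using coercive[OF D(1)] by linarith
    also have "1/2 * (\<nu> * (d\<^sup>2 - d ^ 3)) - (M / 2 * d ^ 3 + K * d ^ 3)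
        = d\<^sup>2 / 2 * (\<nu> - d * (\<nu> + M + 2 * K))"
      by (simp add: power2_eq_square power3_eq_cube algebra_simps)
    finally have "E W' - E V \<ge> d\<^sup>2 / 2 * (\<nu> - d * (\<nu> + M + 2 * K))" .
    moreover have "d * (\<nu> + M + 2 * K) \<le> \<epsilon> * (\<nu> + M + 2 * K)"
      using d den by (simp add: d_def)
    then have "d\<^sup>2 / 2 * (\<nu> - d * (\<nu> + M + 2 * K)) \<ge> 0"
      using \<epsilon> by (intro mult_nonneg_nonneg) auto
    ultimately show ?thesis
      using W' by simp
  qed
  then show ?thesis
    unfolding local_minimizer_def using V \<epsilon> by blast
qed

lemma norm_difference_projector_le:
  assumes "U \<in> stiefel" "V \<in> stiefel"
  shows "norm (V ** (transpose V ** X) - U ** (transpose U ** X)) \<le> 2 * norm (U - V) * norm X"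
proof -
  have "V ** (transpose V ** X) - U ** (transpose U ** X)
    = V ** (transpose (V - U) ** X) + (V - U) ** (transpose U ** X)"
    by (simp add: transpose_diff matrix_mult.diff_left matrix_mult.diff_right)
  also have "norm \<dots> \<le> norm (transpose (V - U) ** X) + norm ((V - U) ** (transpose U ** X))"
    using norm_triangle_ineq by (metis norm_stiefel_mult[OF assms(2)])
  also have "\<dots> \<le> norm (V - U) * norm X + norm (V - U) * norm X"
  proof (rule add_mono)
    show "norm (transpose (V - U) ** X) \<le> norm (V - U) * norm X"
      using norm_matrix_mult_le[of "transpose (V - U)" X] by (simp add: norm_transpose)
    show "norm ((V - U) ** (transpose U ** X)) \<le> norm (V - U) * norm X"
      by (rule order_trans[OF norm_matrix_mult_le])
        (intro mult_left_mono norm_stiefel_transpose_mult_le assms norm_ge_zero)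
  qed
  finally show ?thesis
    by (simp add: norm_minus_commute[of V U] mult_ac)
qed

lemma grad_G_lipschitz:
  assumes U: "U \<in> stiefel" and V: "V \<in> stiefel"
  shows "norm (grad_G E U - grad_G E V) \<le> lip * norm (U - V)"
proof -
  let ?G = "gradient E"
  have "grad_G E U - grad_G E V
    = horizontal U (?G U - ?G V) + (V ** (transpose V ** ?G V) - U ** (transpose U ** ?G V))"
    by (simp add: grad_G_eq horizontal_eq matrix_mult.diff_right)
  also have "norm \<dots> \<le> norm (horizontal U (?G U - ?G V))
      + norm (V ** (transpose V ** ?G V) - U ** (transpose U ** ?G V))"
    by (rule norm_triangle_ineq)
  also have "\<dots> \<le> L0 * norm (U - V) + 2 * norm (U - V) * C0"
  proof (rule add_mono)
    show "norm (horizontal U (?G U - ?G V)) \<le> L0 * norm (U - V)"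
      using norm_horizontal_le[OF U] grad_lipschitz[OF U V] order_trans by blast
    show "norm (V ** (transpose V ** ?G V) - U ** (transpose U ** ?G V)) \<le> 2 * norm (U - V) * C0"
      by (rule order_trans[OF norm_difference_projector_le[OF U V]])
        (intro mult_left_mono grad_le V, simp)
  qed
  finally show ?thesis
    by (simp add: lip_def algebra_simps)
qed

definition "newton_const = L0 + C0 + 2 * K"

lemma newton_const_nonneg: "newton_const \<ge> 0"
  using L0_pos C0_pos K_nonneg by (simp add: newton_const_def)

text \<open>The horizontal displacement to an aligned critical point solves the Newton equation up to second
order. Criticality of \<^term>\<open>V\<close> says \<open>\<nabla>E(V) = V N\<close> for its multiplier \<open>N\<close>, whose horizontal
part at \<^term>\<open>U\<close> is the horizontal displacement times \<open>N\<close>. Comparing with the Taylor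
expansion of the gradient and replacing \<open>N\<close> by the multiplier at \<^term>\<open>U\<close> leaves only
second-order terms, since by alignment the vertical displacement is of second order too.\<close>

lemma newton_equation_residual:
  assumes U: "U \<in> stiefel" and V: "V \<in> stiefel" and crit: "grad_G E V = 0"
    and sym: "transpose (transpose U ** V) = transpose U ** V"
  shows "norm (hess_G E U (horizontal U (V - U)) + grad_G E U) \<le> newton_const * (norm (V - U))\<^sup>2"
proof -
  let ?\<Delta> = "V - U" and ?G = "gradient E"
  define d where "d = norm ?\<Delta>"
  define T where "T = horizontal U ?\<Delta>"
  define Y where "Y = U ** (transpose U ** ?\<Delta>)"
  define e where "e = ?G V - ?G U - hessian E U ?\<Delta>"
  let ?NU = "transpose U ** ?G U" and ?NV = "transpose V ** ?G V"
  have T: "T \<in> tangent U" "norm T \<le> d"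
    by (simp_all add: T_def d_def horizontal_tangent norm_horizontal_le U)
  have Y: "norm Y \<le> 1/2 * d\<^sup>2"
    using norm_symmetric_offset_le[OF U V sym] by (simp add: Y_def d_def norm_stiefel_mult[OF U])
  have e: "norm e \<le> K * d\<^sup>2"
    unfolding e_def d_def by (rule grad_taylor[OF U V])
  have "?G V = V ** ?NV"
    using crit by (simp add: grad_G_eq horizontal_eq)
  moreover have "horizontal U V = T"
    by (simp add: T_def horizontal_eq matrix_mult.diff_right stiefelD[OF U])
  ultimately have GV: "horizontal U (?G V) = T ** ?NV"
    by (metis horizontal_def matrix_mul_assoc)
  have "hessian E U T = hessian E U ?\<Delta> - hessian E U Y"
    by (simp add: T_def Y_def horizontal_eq linear_diff[OF hess_linear[OF U]])
  then have "hess_G E U T = horizontal U (hessian E U ?\<Delta>) - horizontal U (hessian E U Y) - T ** ?NU"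
    by (simp add: hess_G_def horizontal_def matrix_mult.diff_right matrix_mul_assoc)
  moreover have "hessian E U ?\<Delta> = ?G V - ?G U - e"
    by (simp add: e_def)
  ultimately have "hess_G E U T + grad_G E U = T ** (?NV - ?NU) - horizontal U e - horizontal U (hessian E U Y)"
    by (simp add: horizontal_diff GV grad_G_eq matrix_mult.diff_right)
  then have "norm (hess_G E U T + grad_G E U)
    \<le> norm (T ** (?NV - ?NU)) + norm (horizontal U e) + norm (horizontal U (hessian E U Y))"
    using norm_triangle_ineq4[of "T ** (?NV - ?NU) - horizontal U e" "horizontal U (hessian E U Y)"]
      norm_triangle_ineq4[of "T ** (?NV - ?NU)" "horizontal U e"] by simp
  moreover have "norm (T ** (?NV - ?NU)) \<le> d * ((L0 + C0) * d)"
  proof -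
    have "?NV - ?NU = transpose V ** (?G V - ?G U) + transpose ?\<Delta> ** ?G U"
      by (simp add: matrix_mult.diff_right matrix_mult.diff_left transpose_diff)
    moreover have "norm (transpose V ** (?G V - ?G U)) \<le> L0 * d"
      unfolding d_def
      using norm_stiefel_transpose_mult_le[OF V] grad_lipschitz[OF V U] order_trans by blast
    moreover have "norm (transpose ?\<Delta> ** ?G U) \<le> d * C0"
      by (rule order_trans[OF norm_matrix_mult_le])
        (simp add: norm_transpose d_def mult_left_mono grad_le U)
    ultimately have "norm (?NV - ?NU) \<le> (L0 + C0) * d"
      using norm_triangle_ineq[of "transpose V ** (?G V - ?G U)" "transpose ?\<Delta> ** ?G U"]
      by (simp add: algebra_simps)
    then show ?thesis
      using norm_matrix_mult_le[of T "?NV - ?NU"] T(2)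
      by (smt (verit, best) mult_mono norm_ge_zero)
  qed
  moreover have "norm (horizontal U e) \<le> K * d\<^sup>2"
    using norm_horizontal_le[OF U] e order_trans by blast
  moreover have "norm (horizontal U (hessian E U Y)) \<le> K * (1/2 * d\<^sup>2)"
    using norm_horizontal_le[OF U, of "hessian E U Y"] hess_le[OF U, of Y] mult_left_mono[OF Y K_nonneg]
    by linarith
  moreover have "K * (1/2 * d\<^sup>2) \<le> K * d\<^sup>2"
    using K_nonneg by (intro mult_left_mono) auto
  ultimately show ?thesis
    by (simp add: T_def d_def newton_const_def power2_eq_square algebra_simps)
qed

end

section \<open>Descent along a retraction\<close>

text \<open>Local smooth extendability gives differentiability along the line \<open>s \<mapsto> (U, D, s)\<close>, which stays in the
domain of the retraction.\<close>

lemma retraction_has_vector_derivative: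
  fixes ortho :: "real^'k^'g \<Rightarrow> real^'k^'g \<Rightarrow> real \<Rightarrow> real^'k^'g"
  assumes retr: "stiefel_retraction ortho" and UD: "U \<in> stiefel" "D \<in> tangent U"
  shows "(ortho U D has_vector_derivative vector_derivative (ortho U D) (at t)) (at t)"
proof -
  define S :: "((real^'k^'g) \<times> (real^'k^'g) \<times> real) set"
    where "S = {(U, D, t). U \<in> stiefel \<and> D \<in> tangent U}"
  have "smooth_on S (\<lambda>(U, D, t). ortho U D t)"
    using retr by (simp add: stiefel_retraction_def S_def)
  moreover have curve: "(U, D, s) \<in> S" for s
    using UD by (simp add: S_def)
  ultimately obtain W F where W: "open W" "(U, D, t) \<in> W"
    and Ck: "\<And>k. Ck_on k F W" and F: "\<forall>y\<in>S \<inter> W. F y = (\<lambda>(U, D, t). ortho U D t) y"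
    unfolding smooth_on_def by metis
  have "F differentiable at (U, D, t)"
    using Ck[of 1] W by simp
  then obtain F' where F': "(F has_derivative F') (at (U, D, t))"
    by (auto simp: differentiable_def)
  have "((\<lambda>s. (U, D, s)) has_derivative (\<lambda>h. (0, 0, h))) (at t)"
    by (intro derivative_eq_intros) auto
  then have "((\<lambda>s. F (U, D, s)) has_derivative (\<lambda>h. F' (0, 0, h))) (at t)"
    using F' by (rule has_derivative_compose)
  moreover have "open {s. (U, D, s) \<in> W}"
    using open_vimage[OF W(1), of "\<lambda>s. (U, D, s)"] by (simp add: vimage_def continuous_intros)
  ultimately have "(ortho U D has_derivative (\<lambda>h. F' (0, 0, h))) (at t)"
    by (rule has_derivative_transform_within_open) (use W F curve in auto)
  then have "ortho U D differentiable at t"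
    by (rule differentiableI)
  then show ?thesis
    by (simp add: vector_derivative_works)
qed

text \<open>The retraction bounds say that a step follows its tangent line up to second order in the length
of the step, uniformly in the base point.\<close>

locale retracted_energy = grassmann_energy E K C0 L0
  for E :: "real^'k^'g \<Rightarrow> real" and K C0 L0 :: real +
  fixes ortho :: "real^'k^'g \<Rightarrow> real^'k^'g \<Rightarrow> real \<Rightarrow> real^'k^'g" and C1 :: real
  assumes retraction: "stiefel_retraction ortho"
    and C1_pos: "C1 > 0"
    and step_le: "U \<in> stiefel \<Longrightarrow> D \<in> tangent U \<Longrightarrow> t \<ge> 0 \<Longrightarrow>
      norm (ortho U D t - U) \<le> C1 * t * norm D"
    and velocity_le: "U \<in> stiefel \<Longrightarrow> D \<in> tangent U \<Longrightarrow> t \<ge> 0 \<Longrightarrow>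
      norm (vector_derivative (ortho U D) (at t) - D) \<le> C1 * t * (norm D)\<^sup>2"
begin

lemma ortho_stiefel: "U \<in> stiefel \<Longrightarrow> D \<in> tangent U \<Longrightarrow> ortho U D t \<in> stiefel"
  using retraction by (simp add: stiefel_retraction_def)

lemma ortho_remainder_le:
  assumes U: "U \<in> stiefel" and D: "D \<in> tangent U" and t: "t \<ge> 0"
  shows "norm (ortho U D t - U - t *\<^sub>R D) \<le> C1 * t\<^sup>2 * (norm D)\<^sup>2"
proof -
  let ?f' = "\<lambda>s. vector_derivative (ortho U D) (at s)"
  have start: "ortho U D 0 = U" "?f' 0 = D"
    using retraction U D by (auto simp: stiefel_retraction_def intro: vector_derivative_at)
  have "norm (ortho U D t - ortho U D 0 - (t - 0) *\<^sub>R ?f' 0) \<le> norm (t - 0) * (C1 * t * (norm D)\<^sup>2)"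
  proof (rule vector_differentiable_bound_linearization[where S = "{0..t}" and f' = ?f'])
    fix s
    assume s: "s \<in> {0..t}"
    show "(ortho U D has_vector_derivative ?f' s) (at s within {0..t})"
      by (rule has_vector_derivative_at_within[OF retraction_has_vector_derivative[OF retraction U D]])
    have "norm (?f' s - D) \<le> C1 * s * (norm D)\<^sup>2"
      using velocity_le[OF U D] s by simp
    also have "\<dots> \<le> C1 * t * (norm D)\<^sup>2"
      using s C1_pos by (intro mult_right_mono mult_left_mono) auto
    finally show "norm (?f' s - ?f' 0) \<le> C1 * t * (norm D)\<^sup>2"
      by (simp add: start)
  qed (use t in \<open>auto simp: closed_segment_eq_real_ivl\<close>)
  then show ?thesis
    using t by (simp add: start power2_eq_square mult_ac)
qed

text \<open>The retraction leaves the tangent line by a quadratic remainder, to which the expansion for a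
displacement close to a tangent vector applies.\<close>

lemma energy_along_retraction:
  assumes U: "U \<in> stiefel" and D: "D \<in> tangent U" and t: "t \<ge> 0"
  shows "E (ortho U D t) \<le> E U + t * inner (grad_G E U) D + t\<^sup>2 / 2 * hess_G2 E U D D
    + ((norm (grad_G E U) + M / 2 * ((C1 + 1) * (t * norm D))) * C1 * (t * norm D)\<^sup>2
    + K * C1 ^ 3 * (t * norm D) ^ 3)"
proof -
  let ?V = "ortho U D t" and ?R = "ortho U D t - U - t *\<^sub>R D"
  define \<tau> where "\<tau> = t * norm D"
  have \<tau>: "\<tau> \<ge> 0" using t by (simp add: \<tau>_def)
  have \<Delta>: "norm (?V - U) \<le> C1 * \<tau>"
    using step_le[OF U D t] by (simp add: \<tau>_def mult.assoc)
  have R: "norm ?R \<le> C1 * \<tau>\<^sup>2"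
    using ortho_remainder_le[OF U D t] by (simp add: \<tau>_def power_mult_distrib mult.assoc)
  have "(norm (grad_G E U) + M / 2 * (norm (?V - U) + t * norm D)) * norm ?R
    \<le> (norm (grad_G E U) + M / 2 * ((C1 + 1) * \<tau>)) * (C1 * \<tau>\<^sup>2)"
  proof (intro mult_mono add_left_mono mult_left_mono)
    show "norm (?V - U) + t * norm D \<le> (C1 + 1) * \<tau>"
      using \<Delta> by (simp add: \<tau>_def algebra_simps)
    show "0 \<le> norm (grad_G E U) + M / 2 * ((C1 + 1) * \<tau>)"
      using M_pos C1_pos \<tau> by (intro add_nonneg_nonneg mult_nonneg_nonneg) auto
  qed (use R M_pos t in \<open>auto simp: \<tau>_def\<close>)
  moreover have "K * norm (?V - U) ^ 3 \<le> K * (C1 * \<tau>) ^ 3"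
    by (intro mult_left_mono power_mono \<Delta> K_nonneg) auto
  ultimately show ?thesis
    using energy_along_tangent[OF U ortho_stiefel[OF U D] D t, of t]
    unfolding \<tau>_def[symmetric] by (simp add: power_mult_distrib mult.assoc abs_le_iff)
qed

text \<open>The bound \<^term>\<open>b\<close> on the length of the step absorbs the cubic terms into the quadratic one.\<close>

lemma descent:
  obtains C where "C > 0"
    "\<And>U D t. U \<in> stiefel \<Longrightarrow> D \<in> tangent U \<Longrightarrow> t \<ge> 0 \<Longrightarrow> t * norm D \<le> b \<Longrightarrow>
      E (ortho U D t) \<le> E U + t * inner (grad_G E U) D + C * (t * norm D)\<^sup>2"
proof
  define C where "C = M / 2 + (C0 + M / 2 * ((C1 + 1) * \<bar>b\<bar>)) * C1 + K * C1 ^ 3 * \<bar>b\<bar>"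
  show "C > 0"
    unfolding C_def using M_pos C0_pos C1_pos K_nonneg
    by (intro add_pos_nonneg mult_nonneg_nonneg add_nonneg_nonneg) auto
  fix U D :: "real^'k^'g" and t :: real
  assume U: "U \<in> stiefel" and D: "D \<in> tangent U" and t: "t \<ge> 0" and b: "t * norm D \<le> b"
  define \<tau> where "\<tau> = t * norm D"
  have \<tau>: "0 \<le> \<tau>" "\<tau> \<le> \<bar>b\<bar>"
    using t b by (auto simp: \<tau>_def)
  have "t\<^sup>2 / 2 * hess_G2 E U D D \<le> t\<^sup>2 / 2 * (M * (norm D)\<^sup>2)"
    by (intro mult_left_mono hess_G2_le U D) auto
  then have 1: "t\<^sup>2 / 2 * hess_G2 E U D D \<le> M / 2 * \<tau>\<^sup>2"
    by (simp add: \<tau>_def power_mult_distrib mult_ac)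
  have 2: "(norm (grad_G E U) + M / 2 * ((C1 + 1) * \<tau>)) * C1 * \<tau>\<^sup>2
    \<le> (C0 + M / 2 * ((C1 + 1) * \<bar>b\<bar>)) * C1 * \<tau>\<^sup>2"
    using \<tau> C1_pos M_pos
    by (intro mult_right_mono add_mono norm_grad_G_le U mult_left_mono) auto
  have "K * C1 ^ 3 * \<tau>\<^sup>2 * \<tau> \<le> K * C1 ^ 3 * \<tau>\<^sup>2 * \<bar>b\<bar>"
    using \<tau> K_nonneg C1_pos by (intro mult_left_mono) auto
  then have 3: "K * C1 ^ 3 * \<tau> ^ 3 \<le> K * C1 ^ 3 * \<bar>b\<bar> * \<tau>\<^sup>2"
    by (simp add: power2_eq_square power3_eq_cube mult_ac)
  have "C * \<tau>\<^sup>2 = M / 2 * \<tau>\<^sup>2 + (C0 + M / 2 * ((C1 + 1) * \<bar>b\<bar>)) * C1 * \<tau>\<^sup>2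
      + K * C1 ^ 3 * \<bar>b\<bar> * \<tau>\<^sup>2"
    by (simp add: C_def algebra_simps)
  then show "E (ortho U D t) \<le> E U + t * inner (grad_G E U) D + C * (t * norm D)\<^sup>2"
    using energy_along_retraction[OF U D t] 1 2 3 unfolding \<tau>_def[symmetric] by linarith
qed

text \<open>Otherwise a short retracted step along the negative gradient would decrease the energy. The step is short
enough for \<open>\<epsilon>\<close>, and with \<open>C t \<le> 1/2\<close> the quadratic term cannot compensate the linear decrease.\<close>

lemma minimal_imp_critical:
  assumes V: "V \<in> stiefel" and \<epsilon>: "\<epsilon> > 0"
    and minimal: "\<And>W. W \<in> stiefel \<Longrightarrow> norm (W - V) \<le> \<epsilon> \<Longrightarrow> E V \<le> E W"
  shows "grad_G E V = 0"
proof (rule ccontr)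
  let ?g = "grad_G E V"
  assume g: "?g \<noteq> 0"
  have D: "- ?g \<in> tangent V"
    using grad_G_tangent[OF V] by (simp add: tangent_iff matrix_mult.minus_right)
  obtain C where C: "C > 0"
    "\<And>U D t. U \<in> stiefel \<Longrightarrow> D \<in> tangent U \<Longrightarrow> t \<ge> 0 \<Longrightarrow> t * norm D \<le> C0 \<Longrightarrow>
      E (ortho U D t) \<le> E U + t * inner (grad_G E U) D + C * (t * norm D)\<^sup>2"
    using descent[where b = C0] by blast
  define t where "t = min 1 (min (\<epsilon> / (C1 * norm ?g)) (1 / (2 * C)))"
  have t: "t > 0" "t \<le> 1" "t \<le> \<epsilon> / (C1 * norm ?g)" "t \<le> 1 / (2 * C)"
    using \<epsilon> C(1) C1_pos g by (auto simp: t_def)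
  have "norm (ortho V (- ?g) t - V) \<le> \<epsilon>"
    using step_le[OF V D, of t] t C1_pos g by (simp add: field_simps)
  then have "E V \<le> E (ortho V (- ?g) t)"
    by (intro minimal ortho_stiefel V D)
  moreover have "t * norm (- ?g) \<le> 1 * C0"
    using t norm_grad_G_le[OF V] by (intro mult_mono) auto
  then have "E (ortho V (- ?g) t) \<le> E V + t * inner ?g (- ?g) + C * (t * norm (- ?g))\<^sup>2"
    using t by (intro C V D) auto
  ultimately have "t * (norm ?g)\<^sup>2 \<le> C * t * (t * (norm ?g)\<^sup>2)"
    by (simp add: power2_norm_eq_inner power_mult_distrib power2_eq_square[of t] mult_ac)
  moreover have "C * t \<le> 1 / 2"
    using t(4) C(1) by (simp add: field_simps)
  then have "C * t * (t * (norm ?g)\<^sup>2) \<le> 1 / 2 * (t * (norm ?g)\<^sup>2)"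
    using t by (intro mult_right_mono) auto
  moreover have "t * (norm ?g)\<^sup>2 > 0"
    using t g by simp
  ultimately show False by linarith
qed

end

section \<open>Newton steps near a nondegenerate minimizer\<close>

text \<open>The assumption on \<open>\<delta>2\<close> is that a step of the method from the ball of radius \<open>\<delta>2\<close>, whose
length is at most \<open>C1 lip \<delta>2 / \<nu>\<close>, ends in the ball of radius \<open>\<delta>1\<close>. As the energy does not
increase, the assumption on the level set brings it back to radius \<open>\<delta>2\<close>.\<close>

locale newton_basin = retracted_energy E K C0 L0 ortho C1
  for E :: "real^'k^'g \<Rightarrow> real" and K C0 L0 :: real
    and ortho :: "real^'k^'g \<Rightarrow> real^'k^'g \<Rightarrow> real \<Rightarrow> real^'k^'g" and C1 :: real +
  fixes Ustar :: "real^'k^'g" and \<nu> \<delta>1 \<delta>2 E0 q \<eta> :: real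
  assumes minimizer: "local_minimizer E Ustar"
    and \<nu>_pos: "\<nu> > 0"
    and coercive: "U \<in> stiefel \<Longrightarrow> dist_F U Ustar \<le> \<delta>1 \<Longrightarrow> D \<in> tangent U \<Longrightarrow>
      \<nu> * (norm D)\<^sup>2 \<le> hess_G2 E U D D"
    and unique: "local_minimizer E V \<Longrightarrow> dist_F V Ustar \<le> \<delta>1 \<Longrightarrow> dist_F V Ustar = 0"
    and \<delta>2_pos: "\<delta>2 > 0"
    and \<delta>2_small: "\<delta>2 * (1 + C1 * lip / \<nu>) \<le> \<delta>1"
    and level: "U \<in> stiefel \<Longrightarrow> E U \<le> E0 \<Longrightarrow> dist_F U Ustar \<le> \<delta>1 \<Longrightarrow> dist_F U Ustar \<le> \<delta>2"
    and q: "0 < q" "q < 1"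
    and \<eta>: "0 < \<eta>" "\<eta> < 1/4"
begin

lemma Ustar: "Ustar \<in> stiefel"
  using minimizer by (simp add: local_minimizer_def)

lemma \<delta>2_le_\<delta>1: "\<delta>2 \<le> \<delta>1"
proof -
  have "\<delta>2 * 1 \<le> \<delta>2 * (1 + C1 * lip / \<nu>)"
    using \<delta>2_pos C1_pos lip_pos \<nu>_pos by (intro mult_left_mono) auto
  then show ?thesis
    using \<delta>2_small by simp
qed

text \<open>Every representative of the minimizing class minimizes the energy locally on the Stiefel manifold,
so the gradient may be compared with the closest representative.\<close>

lemma critical_minimizer:
  assumes P: "orthogonal_matrix P"
  shows "grad_G E (Ustar ** P) = 0"
proof -
  obtain \<epsilon> where \<epsilon>: "\<epsilon> > 0" "\<forall>V\<in>stiefel. cls V \<in> gr_ball Ustar \<epsilon> \<longrightarrow> E Ustar \<le> E V"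
    using minimizer by (auto simp: local_minimizer_def)
  have "E (Ustar ** P) \<le> E W" if "W \<in> stiefel" "norm (W - Ustar ** P) \<le> \<epsilon>" for W
  proof -
    have "cls W \<in> gr_ball Ustar \<epsilon>"
      using dist_F_le[OF P, of W Ustar] that by (simp add: gr_ball_iff Ustar)
    then show ?thesis
      using \<epsilon> that by (simp add: invariant P)
  qed
  then show ?thesis
    by (rule minimal_imp_critical[OF stiefel_mult_orthogonal[OF Ustar P] \<epsilon>(1)])
qed

lemma norm_grad_G_le_dist:
  assumes U: "U \<in> stiefel"
  shows "norm (grad_G E U) \<le> lip * dist_F U Ustar"
proof -
  obtain P where P: "orthogonal_matrix P" "dist_F U Ustar = norm (U - Ustar ** P)"
    using aligned_representative[OF U Ustar] by metis
  then show ?thesis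
    using grad_G_lipschitz[OF U stiefel_mult_orthogonal[OF Ustar P(1)]]
    by (simp add: critical_minimizer)
qed

lemma continuous_on_dist_F: "continuous_on stiefel (\<lambda>U. dist_F U Ustar)"
proof (rule continuous_onI)
  fix U :: "real^'k^'g" and \<epsilon> :: real
  assume U: "U \<in> stiefel" and \<epsilon>: "\<epsilon> > 0"
  show "\<exists>d>0. \<forall>V\<in>stiefel. dist V U < d \<longrightarrow> dist (dist_F V Ustar) (dist_F U Ustar) \<le> \<epsilon>"
  proof (intro exI[of _ \<epsilon>] conjI ballI impI \<epsilon>)
    fix V :: "real^'k^'g"
    assume "V \<in> stiefel" "dist V U < \<epsilon>"
    then show "dist (dist_F V Ustar) (dist_F U Ustar) \<le> \<epsilon>"
      using dist_F_triangle[OF U Ustar, of V] dist_F_triangle[of V Ustar U] Ustar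
      by (auto simp: dist_norm norm_minus_commute)
  qed
qed

lemma continuous_on_norm_grad_G: "continuous_on stiefel (\<lambda>U. norm (grad_G E U))"
proof (intro continuous_on_norm continuous_onI)
  fix U :: "real^'k^'g" and \<epsilon> :: real
  assume U: "U \<in> stiefel" and \<epsilon>: "\<epsilon> > 0"
  show "\<exists>d>0. \<forall>V\<in>stiefel. dist V U < d \<longrightarrow> dist (grad_G E V) (grad_G E U) \<le> \<epsilon>"
  proof (intro exI[of _ "\<epsilon> / lip"] conjI ballI impI)
    fix V :: "real^'k^'g"
    assume V: "V \<in> stiefel" and near: "dist V U < \<epsilon> / lip"
    then have "lip * norm (V - U) \<le> \<epsilon>"
      using lip_pos by (simp add: dist_norm field_simps)
    then show "dist (grad_G E V) (grad_G E U) \<le> \<epsilon>"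
      using grad_G_lipschitz[OF V U] by (simp add: dist_norm)
  qed (use \<epsilon> lip_pos in simp)
qed

text \<open>A critical point of the ball is a local minimizer by coercivity, hence lies in the class of the
minimizer. So the gradient has no zero on the compact set of points at distance between
\<open>\<epsilon>\<close> and \<open>\<delta>1\<close>, and its norm has a positive minimum there.\<close>

lemma near_if_gradient_small:
  assumes "\<epsilon> > 0"
  obtains \<gamma> where "\<gamma> > 0"
    "\<And>U. U \<in> stiefel \<Longrightarrow> dist_F U Ustar \<le> \<delta>1 \<Longrightarrow> norm (grad_G E U) < \<gamma> \<Longrightarrow> dist_F U Ustar < \<epsilon>"
proof -
  define A where "A = stiefel \<inter> (\<lambda>U. dist_F U Ustar) -` {\<epsilon>..\<delta>1}"
  have "closed A"
    unfolding A_def using compact_imp_closed[OF compact_stiefel]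
    by (intro continuous_on_closed_vimage[THEN iffD1, rule_format] continuous_closed_preimage
        continuous_on_dist_F) auto
  then have "compact A"
    using compact_Int_closed[OF compact_stiefel, of A] by (simp add: A_def Int_absorb1 inf_assoc[symmetric])
  show ?thesis
  proof (cases "A = {}")
    case True
    then show ?thesis
      using that[of 1] by (force simp: A_def)
  next
    case False
    have "continuous_on A (\<lambda>U. norm (grad_G E U))"
      by (rule continuous_on_subset[OF continuous_on_norm_grad_G]) (simp add: A_def)
    then obtain V where V: "V \<in> A" and least: "\<And>U. U \<in> A \<Longrightarrow> norm (grad_G E V) \<le> norm (grad_G E U)"
      using continuous_attains_inf[OF \<open>compact A\<close> False] by metis
    have V': "V \<in> stiefel" "\<epsilon> \<le> dist_F V Ustar" "dist_F V Ustar \<le> \<delta>1"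
      using V by (auto simp: A_def)
    have "grad_G E V \<noteq> 0"
    proof
      assume "grad_G E V = 0"
      then have "local_minimizer E V"
        by (rule second_order_sufficient[OF V'(1) _ \<nu>_pos coercive[OF V'(1,3)]])
      then show False
        using unique[OF _ V'(3)] V'(2) assms by simp
    qed
    then show ?thesis
      using that[of "norm (grad_G E V)"] least by (force simp: A_def)
  qed
qed

text \<open>Below this tolerance the residual of the Newton equation is at most half of the gradient, so the
direction is at least comparable to the gradient, and the residual paired with the direction
is at most half of the curvature along it.\<close>

definition "\<sigma>0 = min (1/2) (\<nu> / (4 * M))"

lemma \<sigma>0: "0 < \<sigma>0" "\<sigma>0 \<le> 1/2" "\<sigma>0 * (4 * M) \<le> \<nu>"
  using \<nu>_pos M_pos by (auto simp: \<sigma>0_def min_mult_distrib_right)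

definition inexact_newton :: "real \<Rightarrow> real^'k^'g \<Rightarrow> real^'k^'g \<Rightarrow> bool" where
  "inexact_newton \<sigma> U D \<longleftrightarrow> U \<in> stiefel \<and> dist_F U Ustar \<le> \<delta>1 \<and> grad_G E U \<noteq> 0 \<and>
     D \<in> tangent U \<and> norm (hess_G E U D + grad_G E U) \<le> \<sigma> * norm (grad_G E U) \<and> \<sigma> \<le> \<sigma>0"

lemma coercive_norm:
  assumes "U \<in> stiefel" "dist_F U Ustar \<le> \<delta>1" "D \<in> tangent U"
  shows "\<nu> * norm D \<le> norm (hess_G E U D)"
proof (cases "D = 0")
  case False
  have "\<nu> * norm D * norm D \<le> norm (hess_G E U D) * norm D"
    using coercive[OF assms] norm_cauchy_schwarz[of "hess_G E U D" D]
    by (simp add: hess_G2_def power2_eq_square)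
  then show ?thesis
    using False by simp
qed simp

text \<open>Write \<open>r\<close> for the residual, \<open>h\<close> for the Hessian along \<open>D\<close> and \<open>t\<close> for the initial step
length. Then \<open>- \<langle>g, D\<rangle> = h - \<langle>r, D\<rangle>\<close>, and so \<open>(t - 1) h = - \<langle>r, D\<rangle>\<close>. Smallness of
\<open>r\<close> thus makes \<open>D\<close> a descent direction of the size of the gradient and brings \<open>t\<close> close to 1.\<close>

lemma inexact_newton:
  assumes "inexact_newton \<sigma> U D"
  shows "norm (grad_G E U) \<le> 2 * M * norm D"
    and "0 < norm D"
    and "\<nu> * norm D \<le> 2 * norm (grad_G E U)"
    and "inner (grad_G E U) D \<le> - (\<nu> / 2 * (norm D)\<^sup>2)"
    and "t_init E U D * hess_G2 E U D D = - inner (grad_G E U) D"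
    and "\<nu> * (\<bar>t_init E U D - 1\<bar> * norm D) \<le> \<sigma> * norm (grad_G E U)"
    and "1/2 \<le> t_init E U D" and "t_init E U D \<le> 3/2"
    and "t_init E U D * norm D \<le> norm (grad_G E U) / \<nu>"
proof -
  let ?g = "grad_G E U" and ?H = "hess_G E U D"
  define x where "x = norm D"
  define h where "h = hess_G2 E U D D"
  define r where "r = ?H + ?g"
  define t where "t = t_init E U D"
  have U: "U \<in> stiefel" "dist_F U Ustar \<le> \<delta>1" and g: "?g \<noteq> 0" and D: "D \<in> tangent U"
    and r: "norm r \<le> \<sigma> * norm ?g" and \<sigma>: "\<sigma> \<le> \<sigma>0"
    using assms by (auto simp: inexact_newton_def r_def)
  have \<sigma>_half: "\<sigma> * norm ?g \<le> 1/2 * norm ?g"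
    using \<sigma> \<sigma>0 by (intro mult_right_mono) auto
  have H_le: "norm ?H \<le> M * x"
    unfolding x_def by (rule norm_hess_G_le[OF U(1) D])
  have "norm ?g \<le> norm r + norm ?H"
    using norm_triangle_ineq4[of r ?H] by (simp add: r_def)
  then have gx: "norm ?g \<le> 2 * M * x"
    using r \<sigma>_half H_le by linarith
  then show "norm ?g \<le> 2 * M * norm D"
    by (simp add: x_def)
  have x: "x > 0"
  proof -
    have "D \<noteq> 0"
      using gx g by (auto simp: x_def)
    then show ?thesis by (simp add: x_def)
  qed
  then show "0 < norm D" by (simp add: x_def)
  have "norm ?H \<le> norm r + norm ?g"
    using norm_triangle_ineq4[of r ?g] by (simp add: r_def)
  then have "norm ?H \<le> 2 * norm ?g"
    using r \<sigma>_half norm_ge_zero[of ?g] by linarith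
  then show "\<nu> * norm D \<le> 2 * norm ?g"
    using coercive_norm[OF U D] by linarith
  have h: "\<nu> * x\<^sup>2 \<le> h"
    unfolding x_def h_def by (rule coercive[OF U D])
  then have h_pos: "h > 0"
    using x \<nu>_pos by (smt (verit) mult_pos_pos zero_less_power)
  have rD: "\<bar>inner r D\<bar> \<le> \<sigma> * norm ?g * x"
    unfolding x_def by (rule abs_inner_le[OF r]) simp
  have "\<sigma> * norm ?g * x \<le> \<sigma>0 * (2 * M * x) * x"
    using x \<sigma> \<sigma>0 gx by (intro mult_right_mono mult_mono) auto
  also have "\<dots> = \<sigma>0 * (4 * M) * (x\<^sup>2 / 2)"
    by (simp add: power2_eq_square)
  also have "\<dots> \<le> \<nu> * (x\<^sup>2 / 2)"
    using \<sigma>0(3) by (intro mult_right_mono) auto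
  finally have rD2: "\<bar>inner r D\<bar> \<le> \<nu> * x\<^sup>2 / 2"
    using rD by simp
  have gD: "inner ?g D = inner r D - h"
    by (simp add: r_def h_def hess_G2_def inner_add_left)
  then show "inner ?g D \<le> - (\<nu> / 2 * (norm D)\<^sup>2)"
    using rD2 h by (simp add: x_def)
  have th: "t * h = - inner ?g D"
    using h_pos by (simp add: t_def t_init_def h_def)
  then show "t_init E U D * hess_G2 E U D D = - inner ?g D"
    by (simp add: t_def h_def)
  have "(t - 1) * h = - inner r D"
    using th gD by (simp add: algebra_simps)
  then have t1: "\<bar>t - 1\<bar> * h = \<bar>inner r D\<bar>"
    using h_pos by (metis abs_minus abs_mult abs_of_pos)
  have "\<nu> * (\<bar>t - 1\<bar> * x) * x \<le> \<bar>t - 1\<bar> * h"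
    using mult_left_mono[OF h, of "\<bar>t - 1\<bar>"] by (simp add: power2_eq_square mult_ac)
  then have "\<nu> * (\<bar>t - 1\<bar> * x) * x \<le> \<sigma> * norm ?g * x"
    using t1 rD by simp
  then show "\<nu> * (\<bar>t_init E U D - 1\<bar> * norm D) \<le> \<sigma> * norm ?g"
    using x by (simp add: t_def x_def)
  have "\<bar>t - 1\<bar> * h \<le> 1/2 * h"
    using t1 rD2 h by simp
  then have "\<bar>t - 1\<bar> \<le> 1/2"
    using h_pos by simp
  then show "1/2 \<le> t_init E U D" "t_init E U D \<le> 3/2"
    unfolding t_def[symmetric] by linarith+
  then have "t \<ge> 0" by (simp add: t_def)
  have "t * x * \<nu> * x \<le> t * h"
    using mult_left_mono[OF h \<open>t \<ge> 0\<close>] by (simp add: power2_eq_square mult_ac)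
  also have "\<dots> \<le> norm ?g * x"
    using th Cauchy_Schwarz_ineq2[of ?g D] by (simp add: x_def)
  finally have "t * x * \<nu> \<le> norm ?g"
    using x by (simp only: mult_le_cancel_right_pos)
  then show "t_init E U D * norm D \<le> norm ?g / \<nu>"
    using \<nu>_pos by (simp add: t_def x_def field_simps)
qed

text \<open>If backtracking rejects a trial length \<open>s\<close>, the descent estimate forces
\<open>(1 - \<eta>) \<nu> / 2 < C s\<close>. So either the initial length is accepted, which is at
least one half, or the accepted length is at least \<open>q (1 - \<eta>) \<nu> / (2 C)\<close>.\<close>

lemma sufficient_decrease:
  obtains c where "c > 0"
    "\<And>\<sigma> U D U'. inexact_newton \<sigma> U D \<Longrightarrow> newton_step E ortho q \<eta> \<sigma> U D U' \<Longrightarrow>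
       E U' \<le> E U - c * (norm D)\<^sup>2"
proof -
  obtain C where C: "C > 0"
    "\<And>U D t. U \<in> stiefel \<Longrightarrow> D \<in> tangent U \<Longrightarrow> t \<ge> 0 \<Longrightarrow> t * norm D \<le> C0 / \<nu> \<Longrightarrow>
      E (ortho U D t) \<le> E U + t * inner (grad_G E U) D + C * (t * norm D)\<^sup>2"
    using descent[where b = "C0 / \<nu>"] by blast
  define \<tau> where "\<tau> = min (1/2) (q * ((1 - \<eta>) * \<nu> / (2 * C)))"
  have \<tau>: "\<tau> > 0"
    using q \<eta> \<nu>_pos C by (simp add: \<tau>_def)
  show ?thesis
  proof (rule that[of "\<eta> * \<tau> * (\<nu> / 2)"])
    show "\<eta> * \<tau> * (\<nu> / 2) > 0"
      using \<eta> \<tau> \<nu>_pos by simp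
    fix \<sigma> U D U'
    assume inexact: "inexact_newton \<sigma> U D" and step: "newton_step E ortho q \<eta> \<sigma> U D U'"
    note N = inexact_newton[OF inexact]
    have U: "U \<in> stiefel" and D: "D \<in> tangent U"
      using inexact by (auto simp: inexact_newton_def)
    define t where "t j = t_init E U D * q ^ j" for j
    obtain m where m: "armijo E ortho \<eta> U D (t m)" "\<And>j. j < m \<Longrightarrow> \<not> armijo E ortho \<eta> U D (t j)"
      "U' = ortho U D (t m)"
      using step by (auto simp: newton_step_def t_def)
    define a where "a = - inner (grad_G E U) D"
    have a: "\<nu> / 2 * (norm D)\<^sup>2 \<le> a"
      using N(4) by (simp add: a_def)
    have "\<tau> \<le> t m"
    proof (cases m)
      case 0
      then show ?thesis
        using N(7) by (simp add: t_def \<tau>_def)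
    next
      case (Suc j)
      have tj: "t j > 0" "t j \<le> t_init E U D"
        using N(7) q by (auto simp: t_def power_le_one mult_le_cancel_left1)
      have "t j * norm D \<le> norm (grad_G E U) / \<nu>"
        using N(9) mult_right_mono[OF tj(2), of "norm D"] by simp
      also have "\<dots> \<le> C0 / \<nu>"
        using norm_grad_G_le[OF U] \<nu>_pos by (simp add: divide_right_mono)
      finally have "E (ortho U D (t j)) \<le> E U + t j * inner (grad_G E U) D + C * (t j * norm D)\<^sup>2"
        using tj by (intro C(2) U D) auto
      moreover have "E (ortho U D (t j)) > E U + \<eta> * t j * inner (grad_G E U) D"
        using m(2)[of j] Suc by (simp add: armijo_def)
      ultimately have "t j * ((1 - \<eta>) * a) < t j * (C * t j * (norm D)\<^sup>2)"
        by (simp add: a_def power_mult_distrib power2_eq_square algebra_simps)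
      then have "(1 - \<eta>) * a < C * t j * (norm D)\<^sup>2"
        using tj by simp
      moreover have "(1 - \<eta>) * (\<nu> / 2 * (norm D)\<^sup>2) \<le> (1 - \<eta>) * a"
        using a \<eta> by (intro mult_left_mono) auto
      ultimately have "(1 - \<eta>) * \<nu> / 2 * (norm D)\<^sup>2 < C * t j * (norm D)\<^sup>2"
        by simp
      then have "(1 - \<eta>) * \<nu> / 2 < C * t j"
        using N(2) by (simp add: mult_less_cancel_right)
      then have "(1 - \<eta>) * \<nu> / (2 * C) \<le> t j"
        using C(1) by (simp add: field_simps)
      then have "q * ((1 - \<eta>) * \<nu> / (2 * C)) \<le> q * t j"
        using q by (intro mult_left_mono) auto
      then show ?thesis
        by (simp add: Suc t_def \<tau>_def mult_ac min_le_iff_disj)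
    qed
    then have "\<eta> * \<tau> * (\<nu> / 2 * (norm D)\<^sup>2) \<le> \<eta> * t m * a"
      using a \<eta> \<tau> \<nu>_pos by (intro mult_mono) auto
    then show "E U' \<le> E U - \<eta> * \<tau> * (\<nu> / 2) * (norm D)\<^sup>2"
      using m(1,3) by (simp add: armijo_def a_def mult.assoc)
  qed
qed

lemma step_stays_in_basin:
  assumes inexact: "inexact_newton \<sigma> U D" and step: "newton_step E ortho q \<eta> \<sigma> U D U'"
    and near: "dist_F U Ustar \<le> \<delta>2" and energy: "E U' \<le> E0"
  shows "U' \<in> stiefel" "dist_F U' Ustar \<le> \<delta>2"
proof -
  have U: "U \<in> stiefel" and D: "D \<in> tangent U"
    using inexact by (auto simp: inexact_newton_def)
  obtain m where U': "U' = ortho U D (t_init E U D * q ^ m)"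
    using step by (auto simp: newton_step_def)
  show "U' \<in> stiefel"
    unfolding U' by (rule ortho_stiefel[OF U D])
  let ?t = "t_init E U D * q ^ m"
  have t: "0 \<le> ?t" "?t \<le> t_init E U D"
    using inexact_newton(7)[OF inexact] q by (auto simp: power_le_one mult_le_cancel_left1)
  have "norm (U' - U) \<le> C1 * (?t * norm D)"
    unfolding U' using step_le[OF U D t(1)] by (simp add: mult.assoc)
  also have "\<dots> \<le> C1 * (t_init E U D * norm D)"
    using t C1_pos by (intro mult_left_mono mult_right_mono) auto
  also have "\<dots> \<le> C1 * (norm (grad_G E U) / \<nu>)"
    using inexact_newton(9)[OF inexact] C1_pos by (intro mult_left_mono) auto
  also have "\<dots> \<le> C1 * (lip * \<delta>2 / \<nu>)"
  proof (intro mult_left_mono divide_right_mono)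
    show "norm (grad_G E U) \<le> lip * \<delta>2"
      by (rule order_trans[OF norm_grad_G_le_dist[OF U] mult_left_mono[OF near]]) (use lip_pos in simp)
  qed (use C1_pos \<nu>_pos in auto)
  finally have "dist_F U' Ustar \<le> \<delta>2 * (1 + C1 * lip / \<nu>)"
    using dist_F_triangle[OF U Ustar, of U'] near by (simp add: algebra_simps)
  then show "dist_F U' Ustar \<le> \<delta>2"
    using \<delta>2_small by (intro level \<open>U' \<in> stiefel\<close> energy) simp
qed

text \<open>For a quadratic model the initial length minimizes the energy along \<open>D\<close> and decreases it by half of
\<open>t \<bar>\<langle>g, D\<rangle>\<bar>\<close>. As \<open>\<eta> < 1/4\<close>, at least a quarter is left to pay for the
cubic remainder, and this suffices for short directions.\<close>

lemma full_step_accepted: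
  obtains \<epsilon> where "\<epsilon> > 0"
    "\<And>\<sigma> U D U'. inexact_newton \<sigma> U D \<Longrightarrow> norm D \<le> \<epsilon> \<Longrightarrow> newton_step E ortho q \<eta> \<sigma> U D U' \<Longrightarrow>
       U' = ortho U D (t_init E U D)"
proof -
  define c where "c = (2 * M + M * (C1 + 1)) * C1 * 4 + K * C1 ^ 3 * 8"
  have c: "c \<ge> 0"
    using M_pos C1_pos K_nonneg by (simp add: c_def)
  show ?thesis
  proof (rule that[of "\<nu> / (16 * (c + 1))"])
    show "\<nu> / (16 * (c + 1)) > 0"
      using \<nu>_pos c by simp
    fix \<sigma> U D U'
    assume inexact: "inexact_newton \<sigma> U D" and small: "norm D \<le> \<nu> / (16 * (c + 1))"
      and step: "newton_step E ortho q \<eta> \<sigma> U D U'"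
    note N = inexact_newton[OF inexact]
    have U: "U \<in> stiefel" and D: "D \<in> tangent U"
      using inexact by (auto simp: inexact_newton_def)
    define x where "x = norm D"
    define t where "t = t_init E U D"
    define a where "a = - inner (grad_G E U) D"
    have x: "x > 0" using N(2) by (simp add: x_def)
    have t: "1/2 \<le> t" "t \<le> 2" using N(7,8) by (simp_all add: t_def)
    have tx: "0 \<le> t * x" "t * x \<le> 2 * x"
      using t x by auto
    have "(norm (grad_G E U) + M / 2 * ((C1 + 1) * (t * x))) * C1 * (t * x)\<^sup>2
      \<le> (2 * M * x + M / 2 * ((C1 + 1) * (2 * x))) * C1 * (2 * x)\<^sup>2"
      using N(1) tx x M_pos C1_pos
      by (intro mult_mono power_mono add_mono mult_left_mono) (auto simp: x_def)
    moreover have "K * C1 ^ 3 * (t * x) ^ 3 \<le> K * C1 ^ 3 * (2 * x) ^ 3"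
      using tx K_nonneg C1_pos by (intro mult_left_mono power_mono) auto
    moreover have "(2 * M * x + M / 2 * ((C1 + 1) * (2 * x))) * C1 * (2 * x)\<^sup>2 + K * C1 ^ 3 * (2 * x) ^ 3
      = c * x ^ 3"
      by (simp add: c_def power2_eq_square power3_eq_cube algebra_simps)
    moreover have "t\<^sup>2 / 2 * hess_G2 E U D D = t / 2 * (t * hess_G2 E U D D)"
      by (simp add: power2_eq_square)
    then have "t\<^sup>2 / 2 * hess_G2 E U D D = t / 2 * a"
      using N(5) by (simp add: t_def a_def)
    moreover have "t \<ge> 0" using t by simp
    note energy_along_retraction[OF U D this]
    ultimately have E: "E (ortho U D t) \<le> E U - t / 2 * a + c * x ^ 3"
      unfolding x_def a_def by simp
    have ta: "t * a \<ge> 1/2 * (\<nu> / 2 * x\<^sup>2)"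
      using t N(4) \<nu>_pos by (intro mult_mono) (auto simp: a_def x_def)
    have "c * x \<le> (c + 1) * x"
      using x by (simp add: algebra_simps)
    also have "\<dots> \<le> \<nu> / 16"
      using small c by (simp add: x_def field_simps)
    finally have "c * x * x\<^sup>2 \<le> \<nu> / 16 * x\<^sup>2"
      by (intro mult_right_mono) auto
    then have "c * x ^ 3 \<le> 1/4 * (t * a)"
      using ta by (simp add: power2_eq_square power3_eq_cube)
    moreover have "1/4 * (t * a) \<le> (1/2 - \<eta>) * (t * a)"
      using \<eta> order_trans[OF _ ta, of 0] \<nu>_pos by (intro mult_right_mono) auto
    ultimately have "armijo E ortho \<eta> U D t"
      using E by (simp add: armijo_def a_def algebra_simps)
    moreover obtain m where m: "\<And>j. j < m \<Longrightarrow> \<not> armijo E ortho \<eta> U D (t * q ^ j)"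
      "U' = ortho U D (t * q ^ m)"
      using step by (auto simp: newton_step_def t_def)
    ultimately have "m = 0"
      using m(1)[of 0] by auto
    then show "U' = ortho U D (t_init E U D)"
      using m(2) by (simp add: t_def)
  qed
qed

text \<open>Let \<open>V\<close> be the aligned representative of the minimizer and \<open>T\<close>, \<open>Y\<close> the horizontal and
vertical parts of \<open>V - U\<close>. The error after the step is \<open>R + (t - 1) D + (D - T) - Y\<close> with the
remainder \<open>R\<close> of the retraction. Each summand is of second order: \<open>R\<close> by the retraction bound,
\<open>(t - 1) D\<close> because the tolerance is at most the norm of the gradient, \<open>D - T\<close> because both
solve the Newton equation up to second order and the Hessian is coercive, and \<open>Y\<close> by alignment.\<close>

lemma full_step_quadratic:
  obtains c where "c > 0"
    "\<And>\<sigma> U D. inexact_newton \<sigma> U D \<Longrightarrow> \<sigma> \<le> norm (grad_G E U) \<Longrightarrow>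
       dist_F (ortho U D (t_init E U D)) Ustar \<le> c * (dist_F U Ustar)\<^sup>2"
proof -
  define c where "c = C1 * 4 * (2 * lip / \<nu>)\<^sup>2 + lip\<^sup>2 / \<nu> + (lip\<^sup>2 + newton_const) / \<nu> + 1/2"
  show ?thesis
  proof (rule that[of c])
    show "c > 0"
      unfolding c_def using C1_pos lip_pos \<nu>_pos newton_const_nonneg
      by (intro add_nonneg_pos add_nonneg_nonneg) auto
    fix \<sigma> U D
    assume inexact: "inexact_newton \<sigma> U D" and \<sigma>: "\<sigma> \<le> norm (grad_G E U)"
    note N = inexact_newton[OF inexact]
    let ?g = "grad_G E U"
    have U: "U \<in> stiefel" and near: "dist_F U Ustar \<le> \<delta>1" and D: "D \<in> tangent U"
      and r: "norm (hess_G E U D + ?g) \<le> \<sigma> * norm ?g"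
      using inexact by (auto simp: inexact_newton_def)
    define t where "t = t_init E U D"
    have t: "0 \<le> t" "t \<le> 2"
      using N(7,8) by (simp_all add: t_def)
    obtain P where P: "orthogonal_matrix P" and dist: "dist_F U Ustar = norm (U - Ustar ** P)"
      and sym: "transpose (transpose U ** (Ustar ** P)) = transpose U ** (Ustar ** P)"
      using aligned_representative[OF U Ustar] by metis
    define V where "V = Ustar ** P"
    have V: "V \<in> stiefel" "grad_G E V = 0"
      by (simp_all add: V_def stiefel_mult_orthogonal Ustar P critical_minimizer)
    define d where "d = norm (V - U)"
    have d: "dist_F U Ustar = d"
      by (simp add: dist d_def V_def norm_minus_commute)
    have g: "norm ?g \<le> lip * d"
      using norm_grad_G_le_dist[OF U] by (simp add: d)
    have "\<sigma> * norm ?g \<le> norm ?g * norm ?g"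
      using \<sigma> by (intro mult_right_mono) auto
    also have "\<dots> \<le> (lip * d) * (lip * d)"
      using g lip_pos by (intro mult_mono) (auto simp: d_def)
    finally have \<sigma>g: "\<sigma> * norm ?g \<le> lip\<^sup>2 * d\<^sup>2"
      by (simp add: power2_eq_square mult_ac)
    define T where "T = horizontal U (V - U)"
    define Y where "Y = U ** (transpose U ** (V - U))"
    define R where "R = ortho U D t - U - t *\<^sub>R D"
    have T: "T \<in> tangent U"
      by (simp add: T_def horizontal_tangent U)
    have "norm D \<le> 2 * lip / \<nu> * d"
      using N(3) g \<nu>_pos by (simp add: field_simps)
    then have "t * norm D \<le> 2 * (2 * lip / \<nu> * d)"
      using t by (intro mult_mono) auto
    then have "(t * norm D)\<^sup>2 \<le> (2 * (2 * lip / \<nu> * d))\<^sup>2"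
      using t by (intro power_mono) auto
    then have "C1 * (t * norm D)\<^sup>2 \<le> C1 * (2 * (2 * lip / \<nu> * d))\<^sup>2"
      using C1_pos by (intro mult_left_mono) auto
    then have R: "norm R \<le> C1 * 4 * (2 * lip / \<nu>)\<^sup>2 * d\<^sup>2"
      using ortho_remainder_le[OF U D t(1)]
      by (simp add: R_def power_mult_distrib power_divide mult_ac)
    have tD: "norm ((t - 1) *\<^sub>R D) \<le> lip\<^sup>2 / \<nu> * d\<^sup>2"
    proof -
      have "\<nu> * norm ((t - 1) *\<^sub>R D) \<le> lip\<^sup>2 * d\<^sup>2"
        unfolding norm_scaleR using N(6) \<sigma>g by (simp add: t_def)
      then show ?thesis
        using \<nu>_pos by (simp add: pos_le_divide_eq mult.commute)
    qed
    have "\<nu> * norm (D - T) \<le> norm (hess_G E U (D - T))"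
      using D T by (intro coercive_norm U near) (simp add: tangent_iff matrix_mult.diff_right)
    also have "hess_G E U (D - T) = (hess_G E U D + ?g) - (hess_G E U T + ?g)"
      by (simp add: hess_G_diff U D T)
    also have "norm \<dots> \<le> norm (hess_G E U D + ?g) + norm (hess_G E U T + ?g)"
      by (rule norm_triangle_ineq4)
    also have "\<dots> \<le> lip\<^sup>2 * d\<^sup>2 + newton_const * d\<^sup>2"
      using newton_equation_residual[OF U V] sym r \<sigma>g by (auto simp: T_def d_def V_def)
    finally have DT: "norm (D - T) \<le> (lip\<^sup>2 + newton_const) / \<nu> * d\<^sup>2"
      using \<nu>_pos by (simp add: field_simps)
    have Y: "norm Y \<le> 1/2 * d\<^sup>2"
      using norm_symmetric_offset_le[OF U V(1)] sym by (simp add: Y_def d_def V_def norm_stiefel_mult[OF U])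
    have "ortho U D t - V = R + (t - 1) *\<^sub>R D + (D - T) - Y"
      by (simp add: R_def T_def Y_def horizontal_eq algebra_simps)
    then have "norm (ortho U D t - V) \<le> norm R + norm ((t - 1) *\<^sub>R D) + norm (D - T) + norm Y"
      using norm_triangle_ineq4[of "R + (t - 1) *\<^sub>R D + (D - T)" Y]
        norm_triangle_ineq[of "R + (t - 1) *\<^sub>R D" "D - T"] norm_triangle_ineq[of R "(t - 1) *\<^sub>R D"]
      by simp
    also have "\<dots> \<le> c * d\<^sup>2"
      using R tD DT Y by (simp add: c_def distrib_right)
    finally show "dist_F (ortho U D (t_init E U D)) Ustar \<le> c * (dist_F U Ustar)\<^sup>2"
      using dist_F_le[OF P, of "ortho U D t" Ustar] by (simp add: d V_def t_def)
  qed
qed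

section \<open>Convergence of the iteration\<close>

text \<open>Tying the tolerance to the gradient at the current iterate is what makes the convergence quadratic
rather than linear. At a critical point, where the method stops, any admissible positive value will do.\<close>

definition tolerance :: "(real^'k^'g) list \<Rightarrow> real" where
  "tolerance Us = (if grad_G E (last Us) = 0 then \<sigma>0 else min \<sigma>0 (norm (grad_G E (last Us))))"

lemma tolerance: "0 < tolerance Us" "tolerance Us < 1" "tolerance Us \<le> \<sigma>0"
  using \<sigma>0 by (auto simp: tolerance_def)

lemma energy_bounded: obtains B where "\<And>U. U \<in> stiefel \<Longrightarrow> B \<le> E U"
proof -
  have "continuous_on stiefel E"
    using gderiv unfolding gderiv_def
    by (blast intro: continuous_at_imp_continuous_on has_derivative_continuous)
  from continuous_bounded_on_compact[OF compact_stiefel this]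
  obtain B where "\<And>U. U \<in> stiefel \<Longrightarrow> norm (E U) \<le> B" by blast
  then show ?thesis
    using that[of "- B"] by (force simp: abs_le_iff)
qed

context
  fixes U0 :: "real^'k^'g" and U D :: "nat \<Rightarrow> real^'k^'g"
  assumes U0: "U0 \<in> stiefel" "dist_F U0 Ustar \<le> \<delta>2" "E U0 \<le> E0"
    and run: "newton_run E ortho q \<eta> tolerance U0 U D"
begin

definition "\<sigma> n = tolerance (map U [0..<Suc n])"

lemma step: "newton_step E ortho q \<eta> (\<sigma> n) (U n) (D n) (U (Suc n))"
  using run by (simp add: newton_run_def \<sigma>_def)

text \<open>Membership in the basin and validity of the direction are proved together: the direction is
controlled only in the basin, and the next iterate stays in the basin because of that control.\<close>

lemma iterate_in_basin: "U n \<in> stiefel \<and> dist_F (U n) Ustar \<le> \<delta>2 \<and> E (U n) \<le> E0"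
  and iterate_inexact: "inexact_newton (\<sigma> n) (U n) (D n)"
proof -
  have inexact: "inexact_newton (\<sigma> n) (U n) (D n)"
    if "U n \<in> stiefel \<and> dist_F (U n) Ustar \<le> \<delta>2 \<and> E (U n) \<le> E0" for n
    using that run step[of n] \<delta>2_le_\<delta>1 tolerance(3)
    by (auto simp: inexact_newton_def newton_run_def newton_step_def \<sigma>_def)
  show basin: "U n \<in> stiefel \<and> dist_F (U n) Ustar \<le> \<delta>2 \<and> E (U n) \<le> E0" for n
  proof (induction n)
    case 0
    then show ?case
      using run U0 by (simp add: newton_run_def)
  next
    case (Suc n)
    obtain c where c: "c > 0" "\<And>\<sigma> U D U'. inexact_newton \<sigma> U D \<Longrightarrow>
        newton_step E ortho q \<eta> \<sigma> U D U' \<Longrightarrow> E U' \<le> E U - c * (norm D)\<^sup>2"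
      using sufficient_decrease by metis
    have "E (U (Suc n)) \<le> E (U n) - c * (norm (D n))\<^sup>2"
      by (rule c(2)[OF inexact[OF Suc] step])
    then have "E (U (Suc n)) \<le> E0"
      using Suc mult_nonneg_nonneg[OF less_imp_le[OF c(1)], of "(norm (D n))\<^sup>2"]
      by (simp add: algebra_simps)
    then show ?case
      using step_stays_in_basin[OF inexact[OF Suc] step] Suc by simp
  qed
  show "inexact_newton (\<sigma> n) (U n) (D n)"
    by (rule inexact[OF basin])
qed

text \<open>The energies decrease to a limit, and each decrement dominates a multiple of \<open>\<parallel>D\<^sub>n\<parallel>\<^sup>2\<close>.\<close>

lemma directions_vanish: "(\<lambda>n. norm (D n)) \<longlonglongrightarrow> 0"
proof -
  obtain c where c: "c > 0" "\<And>\<sigma> U D U'. inexact_newton \<sigma> U D \<Longrightarrow>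
      newton_step E ortho q \<eta> \<sigma> U D U' \<Longrightarrow> E U' \<le> E U - c * (norm D)\<^sup>2"
    using sufficient_decrease by metis
  have dec: "E (U (Suc n)) \<le> E (U n) - c * (norm (D n))\<^sup>2" for n
    by (rule c(2)[OF iterate_inexact step])
  obtain B where "\<And>U. U \<in> stiefel \<Longrightarrow> B \<le> E U"
    using energy_bounded by blast
  then have B: "\<forall>n. B \<le> E (U n)"
    using iterate_in_basin by blast
  have "decseq (\<lambda>n. E (U n))"
    unfolding decseq_Suc_iff using dec c(1) by (smt (verit) mult_nonneg_nonneg zero_le_power2)
  then obtain L where L: "(\<lambda>n. E (U n)) \<longlonglongrightarrow> L"
    using B by (rule decseq_convergent)
  then have "(\<lambda>n. E (U n) - E (U (Suc n))) \<longlonglongrightarrow> L - L"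
    by (intro tendsto_diff LIMSEQ_Suc)
  then have "(\<lambda>n. (E (U n) - E (U (Suc n))) / c) \<longlonglongrightarrow> 0"
    using tendsto_divide[OF _ tendsto_const[of c]] c(1) by fastforce
  moreover have "\<forall>n. norm ((norm (D n))\<^sup>2) \<le> (E (U n) - E (U (Suc n))) / c"
    using dec c(1) by (simp add: pos_le_divide_eq le_diff_eq add.commute mult.commute)
  ultimately have "(\<lambda>n. (norm (D n))\<^sup>2) \<longlonglongrightarrow> 0"
    by (rule Lim_null_comparison[OF always_eventually, rotated])
  then show ?thesis
    by simp
qed

lemma iterates_converge: "(\<lambda>n. dist_F (U n) Ustar) \<longlonglongrightarrow> 0"
proof (rule LIMSEQ_I)
  fix \<epsilon> :: real
  assume "\<epsilon> > 0"
  then obtain \<gamma> where \<gamma>: "\<gamma> > 0"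
    "\<And>U. U \<in> stiefel \<Longrightarrow> dist_F U Ustar \<le> \<delta>1 \<Longrightarrow> norm (grad_G E U) < \<gamma> \<Longrightarrow> dist_F U Ustar < \<epsilon>"
    using near_if_gradient_small by metis
  have "(\<lambda>n. 2 * M * norm (D n)) \<longlonglongrightarrow> 2 * M * 0"
    by (intro tendsto_mult_left directions_vanish)
  then have "\<forall>\<^sub>F n in sequentially. 2 * M * norm (D n) < \<gamma>"
    using \<gamma>(1) by (intro order_tendstoD) auto
  then obtain N where N: "\<And>n. n \<ge> N \<Longrightarrow> 2 * M * norm (D n) < \<gamma>"
    by (auto simp: eventually_sequentially)
  show "\<exists>N. \<forall>n\<ge>N. norm (dist_F (U n) Ustar - 0) < \<epsilon>"
  proof (intro exI allI impI)
    fix n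
    assume "n \<ge> N"
    then have "norm (grad_G E (U n)) < \<gamma>"
      using N inexact_newton(1)[OF iterate_inexact[of n]] by fastforce
    then have "dist_F (U n) Ustar < \<epsilon>"
      using iterate_in_basin[of n] \<delta>2_le_\<delta>1 by (intro \<gamma>(2)) auto
    then show "norm (dist_F (U n) Ustar - 0) < \<epsilon>"
      using dist_F_nonneg[OF _ Ustar] iterate_in_basin[of n] by simp
  qed
qed

lemma quadratic_convergence:
  obtains c where "c > 0"
    "\<forall>\<^sub>F n in sequentially. dist_F (U (Suc n)) Ustar \<le> c * (dist_F (U n) Ustar)\<^sup>2"
proof -
  obtain \<epsilon> where \<epsilon>: "\<epsilon> > 0" "\<And>\<sigma> U D U'. inexact_newton \<sigma> U D \<Longrightarrow> norm D \<le> \<epsilon> \<Longrightarrow>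
      newton_step E ortho q \<eta> \<sigma> U D U' \<Longrightarrow> U' = ortho U D (t_init E U D)"
    using full_step_accepted by metis
  obtain c where c: "c > 0" "\<And>\<sigma> U D. inexact_newton \<sigma> U D \<Longrightarrow> \<sigma> \<le> norm (grad_G E U) \<Longrightarrow>
      dist_F (ortho U D (t_init E U D)) Ustar \<le> c * (dist_F U Ustar)\<^sup>2"
    using full_step_quadratic by metis
  have "\<forall>\<^sub>F n in sequentially. norm (D n) < \<epsilon>"
    using directions_vanish \<epsilon>(1) by (rule order_tendstoD)
  then have "\<forall>\<^sub>F n in sequentially. dist_F (U (Suc n)) Ustar \<le> c * (dist_F (U n) Ustar)\<^sup>2"
  proof eventually_elim
    case (elim n)
    have "\<sigma> n \<le> norm (grad_G E (U n))"
      using run by (simp add: \<sigma>_def tolerance_def newton_run_def)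
    then show ?case
      using c(2)[OF iterate_inexact[of n]] \<epsilon>(2)[OF iterate_inexact less_imp_le[OF elim] step] by simp
  qed
  then show ?thesis
    using that c(1) by blast
qed

lemma quadratic_convergence_dist_geo:
  "(\<lambda>n. dist_geo (U n) Ustar) \<longlonglongrightarrow> 0 \<and>
   (\<exists>\<zeta>>0. \<forall>\<^sub>F n in sequentially. dist_geo (U (Suc n)) Ustar \<le> \<zeta> * (dist_geo (U n) Ustar)\<^sup>2)"
proof
  have geo: "dist_F (U n) Ustar \<le> dist_geo (U n) Ustar" "dist_geo (U n) Ustar \<le> 2 * dist_F (U n) Ustar"
    "0 \<le> dist_F (U n) Ustar" for n
    using dist_geo_dist_F[OF _ Ustar] dist_F_nonneg[OF _ Ustar] iterate_in_basin[of n] by auto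
  have "(\<lambda>n. 2 * dist_F (U n) Ustar) \<longlonglongrightarrow> 0"
    using tendsto_mult_left[OF iterates_converge, of 2] by simp
  moreover have "\<forall>n. norm (dist_geo (U n) Ustar) \<le> 2 * dist_F (U n) Ustar"
    using geo order_trans[OF geo(3) geo(1)] by simp
  ultimately show "(\<lambda>n. dist_geo (U n) Ustar) \<longlonglongrightarrow> 0"
    by (rule Lim_null_comparison[OF always_eventually, rotated])
  obtain c where c: "c > 0"
    "\<forall>\<^sub>F n in sequentially. dist_F (U (Suc n)) Ustar \<le> c * (dist_F (U n) Ustar)\<^sup>2"
    by (rule quadratic_convergence)
  from c(2) have "\<forall>\<^sub>F n in sequentially. dist_geo (U (Suc n)) Ustar \<le> 2 * c * (dist_geo (U n) Ustar)\<^sup>2"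
  proof eventually_elim
    case (elim n)
    have "c * (dist_F (U n) Ustar)\<^sup>2 \<le> c * (dist_geo (U n) Ustar)\<^sup>2"
      using c(1) geo by (intro mult_left_mono power_mono) auto
    then show ?case
      using geo(2)[of "Suc n"] elim by simp
  qed
  then show "\<exists>\<zeta>>0. \<forall>\<^sub>F n in sequentially. dist_geo (U (Suc n)) Ustar \<le> \<zeta> * (dist_geo (U n) Ustar)\<^sup>2"
    using c(1) by (intro exI[of _ "2 * c"]) auto
qed

end

end

section \<open>The discretized Kohn-Sham energy\<close>

text \<open>The energy only depends on \<open>U U\<^sup>T\<close>, by cyclicity of the trace.\<close>

lemma ks_energy_mult_orthogonal:
  fixes U :: "real^'k^'g"
  assumes P: "orthogonal_matrix P"
  shows "ks_energy L Vext exc (U ** P) = ks_energy L Vext exc U"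
proof -
  have "(U ** P) ** transpose (U ** P) = U ** (P ** transpose P) ** transpose U"
    by (simp add: matrix_transpose_mul matrix_mul_assoc)
  then have density: "electron_density (U ** P) = electron_density U"
    by (simp add: electron_density_def orthogonal_matrix_mult_transpose[OF P])
  have "trace (transpose (U ** P) ** A ** (U ** P)) = trace (transpose U ** A ** U)" for A :: "real^'g^'g"
  proof -
    have "trace (transpose (U ** P) ** A ** (U ** P)) = trace (transpose P ** (transpose U ** A ** U ** P))"
      by (simp add: matrix_transpose_mul matrix_mul_assoc)
    also have "\<dots> = trace ((transpose U ** A ** U ** P) ** transpose P)"
      by (rule trace_mul_sym)
    also have "\<dots> = trace (transpose U ** A ** U ** (P ** transpose P))"
      by (simp add: matrix_mul_assoc)
    finally show ?thesis
      by (simp add: orthogonal_matrix_mult_transpose[OF P])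
  qed
  then show ?thesis
    by (simp add: ks_energy_def density)
qed



theorem theorem3p11:
  fixes L Vext :: "real^'g^'g"
    and exc :: "real^'g \<Rightarrow> real^'g"
    and E :: "real^'k^'g \<Rightarrow> real"
    and ortho :: "real^'k^'g \<Rightarrow> real^'k^'g \<Rightarrow> real \<Rightarrow> real^'k^'g"
    and Ustar U0 :: "real^'k^'g"
    and L0 C0 L1 C1 \<delta>1 \<delta>2 \<nu>1 E0 q \<eta> :: real
  assumes dims: "CARD('k) \<le> CARD('g)"
    and L_sym: "transpose L = L"
    and Vext_sym: "transpose Vext = Vext"
    and energy: "E = ks_energy L Vext exc"
    and E_C3: "\<exists>\<Omega>. open \<Omega> \<and> stiefel \<subseteq> \<Omega> \<and> Ck_on 3 E \<Omega>"
    and C0: "C0 > 0" "\<forall>\<Psi>\<in>stiefel. norm (gradient E \<Psi>) \<le> C0"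
    and L0: "L0 > 0"
      "\<forall>U\<in>stiefel. \<forall>V\<in>stiefel. norm (gradient E U - gradient E V) \<le> L0 * norm (U - V)"
    and L1: "L1 = L0 + 2 * C0"
    and minimizer: "local_minimizer E Ustar"
    and pos: "\<delta>1 > 0" "\<nu>1 > 0"
    and coercive: "\<forall>U\<in>stiefel. cls U \<in> gr_ball Ustar \<delta>1 \<longrightarrow>
      (\<forall>D\<in>tangent U. hess_G2 E U D D \<ge> \<nu>1 * (norm D)\<^sup>2)"
    and unique_minimizer: "\<forall>V. local_minimizer E V \<and> cls V \<in> gr_ball Ustar \<delta>1 \<longrightarrow>
      cls V = cls Ustar"
    and ortho: "stiefel_retraction ortho"
    and C1: "C1 > 0"
      "\<forall>U\<in>stiefel. \<forall>D\<in>tangent U. \<forall>t\<ge>0. norm (ortho U D t - U) \<le> C1 * t * norm D"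
      "\<forall>U\<in>stiefel. \<forall>D\<in>tangent U. \<forall>t\<ge>0.
         norm (vector_derivative (ortho U D) (at t) - D) \<le> C1 * t * (norm D)\<^sup>2"
    and ortho_geodesic: "\<exists>K. \<forall>U\<in>stiefel. \<forall>D\<in>tangent U. \<forall>t\<ge>0. t * norm D < 1 \<longrightarrow>
      \<bar>E (ortho U D t) - E (geodesic U D t)\<bar> \<le> K * (t ^ 3 * norm D ^ 3)"
    and \<delta>2: "0 < \<delta>2" "\<delta>2 < \<delta>1 / (1 + 3 * C1 / \<nu>1 * L1)"
    and E0: "E0 > E Ustar" "level_set E E0 \<inter> gr_ball Ustar \<delta>1 \<subseteq> gr_ball Ustar \<delta>2"
    and q: "0 < q" "q < 1"
    and \<eta>: "0 < \<eta>" "\<eta> < 1/4"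
    and start: "U0 \<in> stiefel" "cls U0 \<in> gr_ball Ustar \<delta>2 \<inter> level_set E E0"
  shows "\<exists>\<sigma>. (\<forall>xs. 0 < \<sigma> xs \<and> \<sigma> xs < 1) \<and>
    (\<forall>U D. newton_run E ortho q \<eta> \<sigma> U0 U D \<longrightarrow>
      (\<lambda>n. dist_geo (U n) Ustar) \<longlonglongrightarrow> 0 \<and>
      (\<exists>\<zeta>>0. \<forall>\<^sub>F n in sequentially.
         dist_geo (U (Suc n)) Ustar \<le> \<zeta> * (dist_geo (U n) Ustar)\<^sup>2))"
proof -
  obtain \<Omega> where \<Omega>: "open \<Omega>" "stiefel \<subseteq> \<Omega>" "Ck_on 3 E \<Omega>"
    using E_C3 by blast
  obtain K where K: "K \<ge> 0"
    "\<And>U. U \<in> stiefel \<Longrightarrow> GDERIV E U :> gradient E U"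
    "\<And>U. U \<in> stiefel \<Longrightarrow> linear (hessian E U)"
    "\<And>U h. U \<in> stiefel \<Longrightarrow> norm (hessian E U h) \<le> K * norm h"
    "\<And>U V. U \<in> stiefel \<Longrightarrow> V \<in> stiefel \<Longrightarrow>
       norm (gradient E V - gradient E U - hessian E U (V - U)) \<le> K * norm (V - U) ^ 2"
    "\<And>U V. U \<in> stiefel \<Longrightarrow> V \<in> stiefel \<Longrightarrow>
       \<bar>E V - E U - inner (gradient E U) (V - U) - 1/2 * inner (hessian E U (V - U)) (V - U)\<bar>
         \<le> K * norm (V - U) ^ 3"
    using uniform_taylor[OF \<Omega>(1,3) compact_stiefel \<Omega>(2)] by blast
  interpret grassmann_energy E K C0 L0
    by (rule grassmann_energy.intro)
      (use K C0 L0 in \<open>auto simp: energy ks_energy_mult_orthogonal\<close>)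
  interpret retracted_energy E K C0 L0 ortho C1
    by unfold_locales (use ortho C1 in auto)
  have Ustar: "Ustar \<in> stiefel"
    using minimizer by (simp add: local_minimizer_def)
  note ball = gr_ball_iff[OF _ Ustar]
  have "\<delta>2 * (1 + C1 * lip / \<nu>1) \<le> \<delta>1"
  proof -
    have L1_lip: "L1 = lip" and "0 \<le> C1 / \<nu>1 * lip"
      using L1 lip_def C1 pos lip_pos by auto
    then have "\<delta>2 * (1 + 3 * C1 / \<nu>1 * L1) < \<delta>1"
      using \<delta>2 by (simp add: pos_less_divide_eq)
    moreover have "\<delta>2 * (1 + C1 / \<nu>1 * lip) \<le> \<delta>2 * (1 + 3 * (C1 / \<nu>1 * lip))"
      using \<open>0 \<le> C1 / \<nu>1 * lip\<close> \<delta>2 by (intro mult_left_mono) auto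
    ultimately show ?thesis
      by (simp add: L1_lip mult.assoc)
  qed
  interpret newton_basin E K C0 L0 ortho C1 Ustar \<nu>1 \<delta>1 \<delta>2 E0 q \<eta>
  proof unfold_locales
    show "dist_F V Ustar = 0" if V: "local_minimizer E V" "dist_F V Ustar \<le> \<delta>1" for V
    proof -
      have "V \<in> stiefel"
        using V by (simp add: local_minimizer_def)
      then show ?thesis
        using unique_minimizer V Ustar by (intro dist_F_eq_0_if_cls_eq) (auto simp: ball)
    qed
    show "dist_F U Ustar \<le> \<delta>2" if U: "U \<in> stiefel" "E U \<le> E0" "dist_F U Ustar \<le> \<delta>1" for U
    proof -
      have "cls U \<in> level_set E E0"
        using U by (auto simp: level_set_def)
      moreover have "cls U \<in> gr_ball Ustar \<delta>1"
        using U by (simp add: ball)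
      ultimately show ?thesis
        using E0(2) U ball by blast
    qed
    show "\<delta>2 * (1 + C1 * lip / \<nu>1) \<le> \<delta>1" by fact
  qed (use minimizer pos coercive \<delta>2 q \<eta> in \<open>auto simp: ball\<close>)
  have "E U0 \<le> E0"
  proof -
    obtain V where "cls V = cls U0" "E V \<le> E0"
      using start(2) by (auto simp: level_set_def)
    then show ?thesis
      using invariant cls_eqE by metis
  qed
  then have "(\<lambda>n. dist_geo (U n) Ustar) \<longlonglongrightarrow> 0 \<and>
      (\<exists>\<zeta>>0. \<forall>\<^sub>F n in sequentially. dist_geo (U (Suc n)) Ustar \<le> \<zeta> * (dist_geo (U n) Ustar)\<^sup>2)"
    if "newton_run E ortho q \<eta> tolerance U0 U D" for U D
    using start that by (intro quadratic_convergence_dist_geo) (auto simp: ball)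
  then show ?thesis
    using tolerance by (intro exI[of _ tolerance]) blast
qed

end
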